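(* Let $0<s<1$, $1<p<\infty$, $d\ge1$ and $m>s$. Let $R>0$ and let $u_0\in L^1(\mathbb R^d)$ be non-negative and compactly supported in the ball $B_R(0)$. Then the mild solution $u$ in $L^1$ of $\partial_tu+(-\Delta_p)^su^m=0$ in $\mathbb R^d\times(0,\infty)$ with $u(0)=u_0$ (i.e. every mild solution of $\frac{du}{dt}+Au\ni0$ on $(0,\infty)$, $u(0)=u_0$) is radially decreasing in space for all $|x|\ge R$ and all $t\ge0$.
   Context: Notation: $L^q=L^q(\mathbb R^d)$, $L^{1\cap\infty}=L^1\cap L^\infty$; for $r\in\mathbb R$, $a>0$, $r^a:=|r|^{a-1}r$ (so $u^m=|u|^{m-1}u$, $r^{p-1}=|r|^{p-2}r$). $[u]_{s,p}:=\big(\int_{\mathbb R^d}\int_{\mathbb R^d}\frac{|u(x)-u(y)|^p}{|x-y|^{d+sp}}\,dy\,dx\big)^{1/p}$; $W^{s,p}=W^{s,p}(\mathbb R^d)$ has norm $(\|u\|_p^p+[u]_{s,p}^p)^{1/p}$. Fractional $p$-Laplacian in $L^2$: for $u\in W^{s,p}\cap L^2$ and $v\in L^2$ one writes $v=(-\Delta_p)^su$ if $\int_{\mathbb R^d}v\xi\,dx=\frac12\int_{\mathbb R^{2d}}\frac{(u(x)-u(y))^{p-1}(\xi(x)-\xi(y))}{|x-y|^{d+sp}}\,d(x,y)$ for all $\xi\in W^{s,p}\cap L^2$. Its part in $L^{1\cap\infty}$ is $(-\Delta_p)^s_{1\cap\infty}:=\{(u,v)\in L^{1\cap\infty}\times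 L^{1\cap\infty}: v=(-\Delta_p)^su\}$. The operator $A$ in $L^1$: $(u,v)\in A$ iff $u,v\in L^1$ and there are $(u_k,v_k)$ with $v_k=(-\Delta_p)^s_{1\cap\infty}(u_k^m)$ for all $k$, $u_k\to u$ in $L^1$ and $v_k\to v$ in $L^1$. Mild solution in $L^1$ with initial datum $u_0\in L^1$: a function $u\in C([0,\infty);L^1)$ with $u(0)=u_0$ such that for every $T>0$ and $\varepsilon>0$ there are a partition $0=t_0<t_1<\dots<t_N=T$ with $\max_i(t_i-t_{i-1})<\varepsilon$ and $u_{0,\varepsilon}=u_0$, $u_{1,\varepsilon},\dots,u_{N,\varepsilon}\in D(A)$ with $u_{i,\varepsilon}+(t_i-t_{i-1})Au_{i,\varepsilon}\ni u_{i-1,\varepsilon}$ for $i\ge1$, such that the step functions $u_\varepsilon(t):=u_{i,\varepsilon}$ for $t\in[t_i,t_{i+1})$ converge to $u$ uniformly in $t$ in the $L^1$-norm on $[0,T)$ as $\varepsilon\to0+$. "Radially decreasing in space for $|x|\ge R$" means that, along every direction $\sigma$ in the unit sphere, $r\mapsto u(r\sigma,t)$ is non-increasing on $[R,\infty)$ (as usual for elements of $L^1$, up to modification on a null set). *)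

theory Defs
  imports "HOL-Analysis.Analysis"
begin

text \<open>
  The space $\mathbb R^d$, $d \ge 1$, is an arbitrary Euclidean space \<open>'a\<close> with \<open>d = DIM('a)\<close>.
  Elements of $L^q$ are represented by Borel functions; equality of such elements is equality
  almost everywhere, and every notion below is invariant under changing Borel representatives.
\<close>

definition spow :: "real \<Rightarrow> real \<Rightarrow> real" where
  "spow r a = \<bar>r\<bar> powr (a - 1) * r"

definition Lspace :: "real \<Rightarrow> ('a::euclidean_space \<Rightarrow> real) set" where
  "Lspace q = {f. f \<in> borel_measurable lborel \<and> integrable lborel (\<lambda>x. \<bar>f x\<bar> powr q)}"

definition Linf :: "('a::euclidean_space \<Rightarrow> real) set" where
  "Linf = {f. f \<in> borel_measurable lborel \<and> (\<exists>C. AE x in lborel. \<bar>f x\<bar> \<le> C)}"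

definition L1_norm :: "('a::euclidean_space \<Rightarrow> real) \<Rightarrow> real" where
  "L1_norm f = (LINT x|lborel. \<bar>f x\<bar>)"

definition L1_tendsto ::
    "('i \<Rightarrow> 'a::euclidean_space \<Rightarrow> real) \<Rightarrow> ('a \<Rightarrow> real) \<Rightarrow> 'i filter \<Rightarrow> bool" where
  "L1_tendsto f g F \<longleftrightarrow> ((\<lambda>i. L1_norm (\<lambda>x. f i x - g x)) \<longlongrightarrow> 0) F"

text \<open>
  In the two singular integrals below the value \<open>0\<close> which division by zero assigns on the
  diagonal \<open>x = y\<close> is immaterial, since the diagonal is a null set.
\<close>

definition frac_Sobolev :: "real \<Rightarrow> real \<Rightarrow> ('a::euclidean_space \<Rightarrow> real) set" where
  "frac_Sobolev s p = {f \<in> Lspace p.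
     integrable (lborel \<Otimes>\<^sub>M lborel)
       (\<lambda>(x, y). \<bar>f x - f y\<bar> powr p / norm (x - y) powr (real DIM('a) + s * p))}"

definition frac_p_Laplacian ::
    "real \<Rightarrow> real \<Rightarrow> (('a::euclidean_space \<Rightarrow> real) \<times> ('a \<Rightarrow> real)) set" where
  "frac_p_Laplacian s p = {(u, v).
     u \<in> frac_Sobolev s p \<inter> Lspace 2 \<and> v \<in> Lspace 2 \<and>
     (\<forall>\<xi> \<in> frac_Sobolev s p \<inter> Lspace 2.
        (LINT x|lborel. v x * \<xi> x) =
        1 / 2 * (LINT (x, y)|(lborel \<Otimes>\<^sub>M lborel).
          spow (u x - u y) (p - 1) * (\<xi> x - \<xi> y) / norm (x - y) powr (real DIM('a) + s * p)))}"

definition frac_p_Laplacian_1inf ::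
    "real \<Rightarrow> real \<Rightarrow> (('a::euclidean_space \<Rightarrow> real) \<times> ('a \<Rightarrow> real)) set" where
  "frac_p_Laplacian_1inf s p =
     frac_p_Laplacian s p \<inter> ((Lspace 1 \<inter> Linf) \<times> (Lspace 1 \<inter> Linf))"

definition A_op ::
    "real \<Rightarrow> real \<Rightarrow> real \<Rightarrow> (('a::euclidean_space \<Rightarrow> real) \<times> ('a \<Rightarrow> real)) set" where
  "A_op s p m = {(u, v). u \<in> Lspace 1 \<and> v \<in> Lspace 1 \<and>
     (\<exists>U V. (\<forall>k. U k \<in> Lspace 1 \<and> ((\<lambda>x. spow (U k x) m), V k) \<in> frac_p_Laplacian_1inf s p) \<and>
        L1_tendsto U u sequentially \<and> L1_tendsto V v sequentially)}"

definition implicit_Euler ::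
    "real \<Rightarrow> real \<Rightarrow> real \<Rightarrow> ('a::euclidean_space \<Rightarrow> real) \<Rightarrow> real \<Rightarrow> real \<Rightarrow>
     nat \<Rightarrow> (nat \<Rightarrow> real) \<Rightarrow> (nat \<Rightarrow> 'a \<Rightarrow> real) \<Rightarrow> bool" where
  "implicit_Euler s p m u0 T \<epsilon> N t U \<longleftrightarrow>
     t 0 = 0 \<and> t N = T \<and> (\<forall>i<N. t i < t (Suc i) \<and> t (Suc i) - t i < \<epsilon>) \<and>
     U 0 = u0 \<and>
     (\<forall>i<N. \<exists>w. (U (Suc i), w) \<in> A_op s p m \<and>
        (AE x in lborel. U (Suc i) x + (t (Suc i) - t i) * w x = U i x))"

definition step_fun ::
    "nat \<Rightarrow> (nat \<Rightarrow> real) \<Rightarrow> (nat \<Rightarrow> 'a \<Rightarrow> real) \<Rightarrow> real \<Rightarrow> 'a \<Rightarrow> real" where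
  "step_fun N t U \<tau> = U (THE i. i < N \<and> t i \<le> \<tau> \<and> \<tau> < t (Suc i))"

text \<open>For each \<open>T\<close> the discretizations form a family indexed by \<open>\<epsilon>\<close>, and the step functions
  converge as \<open>\<epsilon>\<close> decreases to \<open>0\<close>. The values \<open>u t\<close> for \<open>t < 0\<close> are irrelevant.\<close>

definition mild_solution ::
    "real \<Rightarrow> real \<Rightarrow> real \<Rightarrow> ('a::euclidean_space \<Rightarrow> real) \<Rightarrow> (real \<Rightarrow> 'a \<Rightarrow> real) \<Rightarrow> bool" where
  "mild_solution s p m u0 u \<longleftrightarrow>
     (\<forall>t\<ge>0. u t \<in> Lspace 1 \<and> L1_tendsto u (u t) (at t within {0..})) \<and>
     (AE x in lborel. u 0 x = u0 x) \<and>
     (\<forall>T>0. \<exists>N t U.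
        (\<forall>\<epsilon>>0. implicit_Euler s p m u0 T \<epsilon> (N \<epsilon>) (t \<epsilon>) (U \<epsilon>)) \<and>
        (\<forall>\<delta>>0. \<forall>\<^sub>F \<epsilon> in at_right 0. \<forall>\<tau>\<in>{0..<T}.
           L1_norm (\<lambda>x. step_fun (N \<epsilon>) (t \<epsilon>) (U \<epsilon>) \<tau> x - u \<tau> x) < \<delta>))"

definition radially_decreasing_beyond :: "real \<Rightarrow> ('a::euclidean_space \<Rightarrow> real) \<Rightarrow> bool" where
  "radially_decreasing_beyond R f \<longleftrightarrow>
     (\<exists>g. (AE x in lborel. f x = g x) \<and>
        (\<forall>\<sigma>\<in>sphere 0 1. antimono_on {R..} (\<lambda>r. g (r *\<^sub>R \<sigma>))))"

text \<open>The support is the essential one: the complement of the largest open set on which the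
  function vanishes almost everywhere. The ball is open.\<close>

definition ess_support :: "('a::euclidean_space \<Rightarrow> real) \<Rightarrow> 'a set" where
  "ess_support f = - \<Union>{W. open W \<and> (AE x in lborel. x \<in> W \<longrightarrow> f x = 0)}"

definition compactly_supported_in :: "('a::euclidean_space \<Rightarrow> real) \<Rightarrow> 'a set \<Rightarrow> bool" where
  "compactly_supported_in f B \<longleftrightarrow> compact (ess_support f) \<and> ess_support f \<subseteq> B"

end

theory Submission imports Defs begin

text \<open>
  The proof is the method of moving planes, run through the implicit Euler scheme.

  Fix a hyperplane which does not meet the ball containing the support of the initial datum. Initially
  the value at an inner point, on the side of the ball, is at least the value at its mirror image. This
  order is preserved by one Euler step \<open>u + h * w = f\<close>, where \<open>(u, w)\<close> belongs to the operator. In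
  quantitative form, \<open>refl_defect\<close>, the integral of the positive part of the outer minus the inner value,
  is for \<open>u\<close> at most what it is for \<open>f\<close>. For regular solutions this follows by testing the
  equation with an odd function under the reflection, which approximates the indicator function of the set
  where the outer value exceeds the inner one, with opposite signs on the two sides. The resulting energy
  term is non-negative (\<open>energy_refl_test_nonneg\<close>): after averaging over the reflections of both
  variables its integrand is an expression in the values of the solution at two points and their mirror
  images, which has a sign because the kernel is larger between points on the same side than across the
  hyperplane (\<open>four_point_ineq\<close>). The sign uses only the monotonicity of the nonlinearities, so all
  exponents are treated alike.

  The defect is Lipschitz continuous in the norm of \<open>L\<^sup>1\<close>. The estimate thus passes to the closure of the
  regular operator (\<open>refl_defect_resolvent\<close>), iterates over the time steps, and passes to the limit
  (\<open>refl_defect_mild_solution\<close>). The defect is \<open>0\<close> initially, hence at all times.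

  Two points on a ray outside the ball are interchanged by the reflection in their bisecting hyperplane,
  which does not meet the ball. This gives radial monotonicity up to null sets that
  depend on the hyperplane; passing to points of density removes this dependence and yields a
  representative that is monotone on every ray (\<open>radially_decreasing_beyond_if_reflections\<close>).
\<close>

section \<open>Lebesgue measure and hyperplane reflections\<close>

lemma nn_integral_lborel_affine1:
  fixes f :: "'a::euclidean_space \<Rightarrow> ennreal"
  assumes [measurable]: "f \<in> borel_measurable borel" and c: "\<bar>c\<bar> = 1"
  shows "(\<integral>\<^sup>+x. f (t + c *\<^sub>R x) \<partial>lborel) = (\<integral>\<^sup>+x. f x \<partial>lborel)"
proof -
  have "c \<noteq> 0" using c by auto
  then have "(lborel :: 'a measure) = density (distr lborel borel (\<lambda>x. t + c *\<^sub>R x)) (\<lambda>_. \<bar>c\<bar>^DIM('a))"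
    by (rule lborel_affine)
  then have "(lborel :: 'a measure) = distr lborel borel (\<lambda>x. t + c *\<^sub>R x)"
    using c by (simp add: density_1)
  then have "(\<integral>\<^sup>+x. f x \<partial>lborel) = (\<integral>\<^sup>+x. f x \<partial>distr lborel borel (\<lambda>x. t + c *\<^sub>R x))"
    by simp
  then show ?thesis by (simp add: nn_integral_distr)
qed

text \<open>
  Uniqueness of translation invariant measures, with the comparison constant computed on the unit
  ball, which the map preserves. For a measurable set \<open>A\<close> and the ball \<open>B\<close>, translations and
  two applications of Fubini's theorem turn the product of the measures of \<open>f -` A\<close> and \<open>B\<close> into
  the product of the measures of \<open>A\<close> and \<open>B\<close>.
\<close>

lemma lborel_distr_orthogonal_transformation:
  fixes f :: "'a::euclidean_space \<Rightarrow> 'a"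
  assumes f: "orthogonal_transformation f"
  shows "distr lborel borel f = lborel"
proof (rule measure_eqI)
  have lin: "linear f" and nf: "\<And>x. norm (f x) = norm x"
    using f by (auto simp: orthogonal_transformation_linear orthogonal_transformation_norm)
  have [measurable]: "f \<in> borel_measurable borel"
    using linear_continuous_on[OF linear_conv_bounded_linear[THEN iffD1, OF lin]]
    by (intro borel_measurable_continuous_onI)
  define B :: "'a set" where "B = ball 0 1"
  have [measurable]: "B \<in> sets borel" by (simp add: B_def)
  have fB: "indicator B (f x) = (indicator B x :: ennreal)" for x
    by (simp add: B_def indicator_def nf)
  fix A assume "A \<in> sets (distr lborel borel f)"
  then have [measurable]: "A \<in> sets borel" by simp
  define g where "g = inv f"
  have g: "f (g y) = y" for y
    unfolding g_def using orthogonal_transformation_surj[OF f] by (simp add: surj_f_inv_f)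
  have "emeasure lborel (f -` A) * emeasure lborel B
      = (\<integral>\<^sup>+x. indicator A (f x) * (\<integral>\<^sup>+y. indicator B y \<partial>lborel) \<partial>lborel)"
  proof -
    have "(\<integral>\<^sup>+x. indicator A (f x) \<partial>lborel) = (\<integral>\<^sup>+x. indicator (f -` A) x \<partial>lborel)"
      by (simp add: indicator_def)
    also have "\<dots> = emeasure lborel (f -` A)"
      using measurable_sets[of f borel borel A] by (simp)
    finally show ?thesis by (simp add: nn_integral_multc)
  qed
  also have "\<dots> = (\<integral>\<^sup>+x. indicator A (f x) * (\<integral>\<^sup>+y. indicator B (f x + 1 *\<^sub>R y) \<partial>lborel) \<partial>lborel)"
    by (subst nn_integral_lborel_affine1) auto
  also have "\<dots> = (\<integral>\<^sup>+x. \<integral>\<^sup>+y. indicator A (f x) * indicator B (f x + y) \<partial>lborel \<partial>lborel)"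
    by (simp add: nn_integral_cmult)
  also have "\<dots> = (\<integral>\<^sup>+y. \<integral>\<^sup>+x. indicator A (f x) * indicator B (f x + y) \<partial>lborel \<partial>lborel)"
    by (rule lborel_pair.Fubini') measurable
  also have "\<dots> = (\<integral>\<^sup>+y. \<integral>\<^sup>+x. indicator A (f (- g y + 1 *\<^sub>R x)) * indicator B (f (- g y + 1 *\<^sub>R x) + y) \<partial>lborel \<partial>lborel)"
    by (subst nn_integral_lborel_affine1[where f="\<lambda>x. indicator A (f x) * indicator B (f x + _)"]) auto
  also have "\<dots> = (\<integral>\<^sup>+y. \<integral>\<^sup>+x. indicator A (f x - y) * indicator B (f x) \<partial>lborel \<partial>lborel)"
    using lin by (simp add: linear_add linear_neg linear_diff g)
  also have "\<dots> = (\<integral>\<^sup>+x. \<integral>\<^sup>+y. indicator A (f x - y) * indicator B (f x) \<partial>lborel \<partial>lborel)"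
    by (rule lborel_pair.Fubini') measurable
  also have "\<dots> = (\<integral>\<^sup>+x. (\<integral>\<^sup>+y. indicator A (f x + (-1) *\<^sub>R y) \<partial>lborel) * indicator B x \<partial>lborel)"
    by (simp add: nn_integral_multc fB)
  also have "\<dots> = (\<integral>\<^sup>+x. (\<integral>\<^sup>+y. indicator A y \<partial>lborel) * indicator B x \<partial>lborel)"
    by (subst nn_integral_lborel_affine1) auto
  also have "\<dots> = emeasure lborel A * emeasure lborel B"
    by (simp add: nn_integral_cmult)
  finally have "emeasure lborel (f -` A) * emeasure lborel B = emeasure lborel A * emeasure lborel B" .
  moreover have "emeasure lborel B \<noteq> 0" "emeasure lborel B \<noteq> \<infinity>"
    using less_imp_neq[OF unit_ball_vol_pos[of "real DIM('a)"]] by (auto simp: B_def emeasure_ball)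
  ultimately show "emeasure (distr lborel borel f) A = emeasure lborel A"
    by (simp add: emeasure_distr ennreal_mult_cancel_left mult.commute[of _ "emeasure lborel B"])
qed simp

text \<open>
  For a unit vector \<open>\<sigma>\<close> this is the orthogonal reflection in the hyperplane \<open>x \<bullet> \<sigma> = l\<close>. The
  half-space \<open>x \<bullet> \<sigma> \<le> l\<close> is called inner, its complement outer.
\<close>

definition hrefl :: "'a::euclidean_space \<Rightarrow> real \<Rightarrow> 'a \<Rightarrow> 'a" where
  "hrefl \<sigma> l x = x - (2 * (x \<bullet> \<sigma> - l)) *\<^sub>R \<sigma>"

lemma hrefl_measurable [measurable]: "hrefl \<sigma> l \<in> borel_measurable borel"
  unfolding hrefl_def by measurable

lemma inner_hrefl: "norm \<sigma> = 1 \<Longrightarrow> hrefl \<sigma> l x \<bullet> \<sigma> = 2 * l - x \<bullet> \<sigma>"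
  by (simp add: hrefl_def inner_diff_left norm_eq_1 algebra_simps)

lemma hrefl_hrefl [simp]: "norm \<sigma> = 1 \<Longrightarrow> hrefl \<sigma> l (hrefl \<sigma> l x) = x"
  by (simp add: hrefl_def[of _ _ "hrefl \<sigma> l x"] inner_hrefl) (simp add: hrefl_def algebra_simps)

lemma orthogonal_transformation_hrefl0:
  fixes \<sigma> :: "'a::euclidean_space"
  assumes "norm \<sigma> = 1"
  shows "orthogonal_transformation (hrefl \<sigma> 0)"
proof -
  have "linear (hrefl \<sigma> 0)"
    by (rule linearI) (simp_all add: hrefl_def algebra_simps)
  moreover have "\<sigma> \<bullet> \<sigma> = 1" using assms by (simp add: norm_eq_1)
  ultimately show ?thesis
    unfolding orthogonal_transformation_def
    by (auto simp: hrefl_def inner_commute algebra_simps)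
qed

lemma hrefl_eq: "hrefl \<sigma> l x = (2 * l) *\<^sub>R \<sigma> + 1 *\<^sub>R hrefl \<sigma> 0 x"
  by (simp add: hrefl_def algebra_simps)

lemma dist_hrefl:
  assumes "norm \<sigma> = 1" shows "norm (hrefl \<sigma> l x - hrefl \<sigma> l y) = norm (x - y)"
proof -
  have "hrefl \<sigma> l x - hrefl \<sigma> l y = hrefl \<sigma> 0 (x - y)"
    by (simp add: hrefl_def algebra_simps)
  then show ?thesis using orthogonal_transformation_norm[OF orthogonal_transformation_hrefl0[OF assms]] by simp
qed

lemma lborel_distr_hrefl:
  assumes "norm \<sigma> = 1"
  shows "distr lborel borel (hrefl \<sigma> l) = lborel"
proof -
  have "distr lborel borel (hrefl \<sigma> l) = distr (distr lborel borel (hrefl \<sigma> 0)) borel ((+) ((2 * l) *\<^sub>R \<sigma>))"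
    by (subst distr_distr) (auto simp: o_def hrefl_eq[of \<sigma> l] intro!: arg_cong[where f="distr lborel borel"])
  then show ?thesis
    by (simp add: lborel_distr_orthogonal_transformation orthogonal_transformation_hrefl0 assms lborel_distr_plus)
qed

text \<open>
  The reason why the reflection method applies: the kernel is decreasing in the distance, and two
  points on the same side of the hyperplane are at least as close to each other as each of them is
  to the mirror image of the other.
\<close>

lemma hrefl_closer:
  assumes "norm \<sigma> = 1" "x \<bullet> \<sigma> \<le> l" "y \<bullet> \<sigma> \<le> l"
  shows "norm (x - y) \<le> norm (x - hrefl \<sigma> l y)"
proof -
  have s: "\<sigma> \<bullet> \<sigma> = 1" using assms by (simp add: norm_eq_1)
  have "(norm (x - hrefl \<sigma> l y))\<^sup>2 - (norm (x - y))\<^sup>2 = 4 * ((l - x \<bullet> \<sigma>) * (l - y \<bullet> \<sigma>))"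
    unfolding power2_norm_eq_inner hrefl_def
    using s by (simp add: inner_commute algebra_simps power2_eq_square)
  moreover have "0 \<le> (l - x \<bullet> \<sigma>) * (l - y \<bullet> \<sigma>)" using assms by simp
  ultimately have "(norm (x - y))\<^sup>2 \<le> (norm (x - hrefl \<sigma> l y))\<^sup>2" by linarith
  then show ?thesis by (rule power2_le_imp_le) simp
qed

lemma AE_hrefl:
  assumes "norm \<sigma> = 1" "AE x in lborel. P x"
  shows "AE x in lborel. P (hrefl \<sigma> l x)"
  using AE_distrD[of "hrefl \<sigma> l" lborel borel P] assms
  unfolding lborel_distr_hrefl[OF assms(1)] by simp

lemma integrable_hrefl:
  fixes f :: "'a::euclidean_space \<Rightarrow> real"
  assumes "norm \<sigma> = 1" "integrable lborel f"
  shows "integrable lborel (\<lambda>x. f (hrefl \<sigma> l x))"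
  using assms integrable_distr[of "hrefl \<sigma> l" lborel borel f] by (simp add: lborel_distr_hrefl)

lemma integral_hrefl:
  fixes f :: "'a::euclidean_space \<Rightarrow> real"
  assumes "norm \<sigma> = 1" "f \<in> borel_measurable borel"
  shows "(LINT x|lborel. f (hrefl \<sigma> l x)) = (LINT x|lborel. f x)"
  using assms integral_distr[of "hrefl \<sigma> l" lborel borel f] by (simp add: lborel_distr_hrefl)

section \<open>Power functions and the four-point inequality\<close>

lemma spow_minus: "spow (- r) a = - spow r a"
  by (simp add: spow_def)

lemma spow_nonneg_eq: "0 < a \<Longrightarrow> 0 \<le> r \<Longrightarrow> spow r a = r powr a"
  by (cases "r = 0") (auto simp: spow_def powr_mult_base mult.commute)

lemma abs_spow: "0 < a \<Longrightarrow> \<bar>spow r a\<bar> = \<bar>r\<bar> powr a"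
  using spow_nonneg_eq[of a "\<bar>r\<bar>"] by (auto simp: spow_def abs_mult)

lemma spow_less:
  assumes "0 < a" "r < t"
  shows "spow r a < spow t a"
proof (cases "0 \<le> r")
  case True
  then show ?thesis using assms by (simp add: spow_nonneg_eq powr_less_mono2)
next
  case r: False
  show ?thesis
  proof (cases "0 \<le> t")
    case True
    have "spow r a < 0" using r by (auto simp: spow_def mult_less_0_iff)
    also have "0 \<le> spow t a" using True by (simp add: spow_def)
    finally show ?thesis .
  next
    case False
    then have "spow (- t) a < spow (- r) a"
      using assms r by (simp add: spow_nonneg_eq powr_less_mono2)
    then show ?thesis by (simp add: spow_minus)
  qed
qed

lemma spow_mono: "0 < a \<Longrightarrow> r \<le> t \<Longrightarrow> spow r a \<le> spow t a"
  using spow_less[of a r t] by (cases "r = t") auto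

lemma spow_measurable [measurable]: "(\<lambda>r. spow r a) \<in> borel_measurable borel"
  unfolding spow_def by measurable

lemma abs_add_powr_le:
  fixes a b p :: real
  assumes "0 \<le> p"
  shows "\<bar>a + b\<bar> powr p \<le> 2 powr p * (\<bar>a\<bar> powr p + \<bar>b\<bar> powr p)"
proof -
  have "\<bar>a + b\<bar> powr p \<le> (2 * max \<bar>a\<bar> \<bar>b\<bar>) powr p"
    using assms by (intro powr_mono2) auto
  also have "\<dots> = 2 powr p * max \<bar>a\<bar> \<bar>b\<bar> powr p"
    by (simp add: powr_mult)
  also have "\<dots> \<le> 2 powr p * (\<bar>a\<bar> powr p + \<bar>b\<bar> powr p)"
    by (intro mult_left_mono) (auto simp: max_def)
  finally show ?thesis .
qed

text \<open>
  An elementary substitute for Young's inequality, by which the integrand of the energy form is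
  dominated by the two Gagliardo integrands.
\<close>

lemma powr_mult_le_add:
  fixes A B p :: real
  assumes "1 < p" "0 \<le> A" "0 \<le> B"
  shows "A powr (p - 1) * B \<le> A powr p + B powr p"
proof (cases "A \<le> B")
  case True
  have "A powr (p - 1) * B \<le> B powr (p - 1) * B"
    using assms True by (intro mult_right_mono powr_mono2) auto
  also have "\<dots> = B powr p" using assms by (cases "B = 0") (auto simp: powr_mult_base mult.commute)
  finally show ?thesis using powr_ge_zero[of A p] by linarith
next
  case False
  have "A powr (p - 1) * B \<le> A powr (p - 1) * A"
    using False by (intro mult_left_mono) auto
  also have "\<dots> = A powr p" using assms by (cases "A = 0") (auto simp: powr_mult_base mult.commute)
  finally show ?thesis using powr_ge_zero[of B p] by linarith
qed

text \<open>
  The pointwise heart of the proof. Here \<open>a, b\<close> stand for the values of a function at the mirror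
  images of \<open>x, y\<close>, and \<open>c, e\<close> for its values at \<open>x, y\<close>; the weights \<open>K\<close> and \<open>K'\<close> are the
  kernel at \<open>(x, y)\<close> and at \<open>(x, y')\<close>, where \<open>y'\<close> is the mirror image of \<open>y\<close>. The factor of
  \<open>K\<close> is non-negative because \<open>(a - b) - (c - e) = (a - c) - (b - e)\<close>, so it suffices to take
  \<open>K = K'\<close>. Then the coefficient of \<open>\<eta> (a - c)\<close> is
  \<open>(J (a - b) - J (c - b)) + (J (a - e) - J (c - e))\<close>, which is non-negative whenever
  \<open>a \<ge> c\<close>, and \<open>\<eta> (a - c)\<close> vanishes otherwise. The coefficient of \<open>\<eta> (b - e)\<close> is treated in
  the same way. The first alternative of the hypothesis on the weights serves the diagonal,
  where the kernel is \<open>0\<close> by the convention for division by zero.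
\<close>

lemma four_point_ineq:
  fixes J \<eta> :: "real \<Rightarrow> real"
  assumes J: "mono J" and \<eta>: "mono \<eta>" and \<eta>0: "\<And>r. r \<le> 0 \<Longrightarrow> \<eta> r = 0"
    and K: "a = b \<and> c = e \<or> K' \<le> K" "0 \<le> K'"
  shows "0 \<le> (J (a - b) - J (c - e)) * (\<eta> (a - c) - \<eta> (b - e)) * K
            + (J (a - e) - J (c - b)) * (\<eta> (a - c) + \<eta> (b - e)) * K'"
proof -
  have mJ: "x \<le> y \<Longrightarrow> J x \<le> J y" and m\<eta>: "x \<le> y \<Longrightarrow> \<eta> x \<le> \<eta> y" for x y
    using J \<eta> by (auto dest: monoD)
  have \<eta>nn: "0 \<le> \<eta> r" for r using \<eta>0[of 0] \<eta>0[of r] m\<eta>[of 0 r] by (cases "r \<le> 0") auto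
  define T where "T = (J (a - b) - J (c - e)) * (\<eta> (a - c) - \<eta> (b - e))"
  have T: "0 \<le> T"
  proof (cases "a - b \<le> c - e")
    case True
    then show ?thesis unfolding T_def
      using mJ[of "a - b" "c - e"] m\<eta>[of "a - c" "b - e"] by (intro mult_nonpos_nonpos) auto
  next
    case False
    then show ?thesis unfolding T_def
      using mJ[of "c - e" "a - b"] m\<eta>[of "b - e" "a - c"] by (intro mult_nonneg_nonneg) auto
  qed
  have TK: "T * K' \<le> T * K"
    using K(1)
  proof
    assume "a = b \<and> c = e" then show ?thesis by (simp add: T_def)
  next
    assume "K' \<le> K" then show ?thesis using T by (rule mult_left_mono)
  qed
  have x: "0 \<le> \<eta> (a - c) * (J (a - b) - J (c - b) + J (a - e) - J (c - e))"
  proof (cases "a \<le> c")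
    case False
    then show ?thesis using mJ[of "c - b" "a - b"] mJ[of "c - e" "a - e"] \<eta>nn
      by (intro mult_nonneg_nonneg) auto
  qed (simp add: \<eta>0)
  have y: "0 \<le> \<eta> (b - e) * (J (c - e) - J (c - b) + J (a - e) - J (a - b))"
  proof (cases "b \<le> e")
    case False
    then show ?thesis using mJ[of "c - b" "c - e"] mJ[of "a - b" "a - e"] \<eta>nn
      by (intro mult_nonneg_nonneg) auto
  qed (simp add: \<eta>0)
  have "0 \<le> (\<eta> (a - c) * (J (a - b) - J (c - b) + J (a - e) - J (c - e))
            + \<eta> (b - e) * (J (c - e) - J (c - b) + J (a - e) - J (a - b))) * K'"
    using x y K(2) by (intro mult_nonneg_nonneg) auto
  also have "\<dots> = T * K' + (J (a - e) - J (c - b)) * (\<eta> (a - c) + \<eta> (b - e)) * K'"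
    unfolding T_def by (simp add: algebra_simps)
  also have "\<dots> \<le> T * K + (J (a - e) - J (c - b)) * (\<eta> (a - c) + \<eta> (b - e)) * K'"
    using TK by simp
  finally show ?thesis unfolding T_def .
qed

section \<open>Lebesgue and fractional Sobolev spaces under reflection\<close>

lemma lborel_pair_distr:
  fixes f g :: "'a::euclidean_space \<Rightarrow> 'a"
  assumes f: "f \<in> borel_measurable borel" "distr lborel borel f = lborel"
    and g: "g \<in> borel_measurable borel" "distr lborel borel g = lborel"
  shows "distr (lborel \<Otimes>\<^sub>M lborel) (lborel \<Otimes>\<^sub>M lborel) (\<lambda>(x, y). (f x, g y)) = lborel \<Otimes>\<^sub>M lborel"
proof -
  have "distr lborel borel f \<Otimes>\<^sub>M distr lborel borel g
      = distr (lborel \<Otimes>\<^sub>M lborel) (borel \<Otimes>\<^sub>M borel) (\<lambda>(x, y). (f x, g y))"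
    using f g by (intro pair_measure_distr) (auto simp: lborel.sigma_finite_measure_axioms)
  also have "\<dots> = distr (lborel \<Otimes>\<^sub>M lborel) (lborel \<Otimes>\<^sub>M lborel) (\<lambda>(x, y). (f x, g y))"
    by (intro distr_cong) (auto intro: sets_pair_measure_cong)
  finally show ?thesis using f g by simp
qed

lemma
  fixes f g :: "'a::euclidean_space \<Rightarrow> 'a" and h :: "'a \<times> 'a \<Rightarrow> real"
  assumes f: "f \<in> borel_measurable borel" "distr lborel borel f = lborel"
    and g: "g \<in> borel_measurable borel" "distr lborel borel g = lborel"
    and h: "integrable (lborel \<Otimes>\<^sub>M lborel) h"
  shows integrable_pair_distr: "integrable (lborel \<Otimes>\<^sub>M lborel) (\<lambda>(x, y). h (f x, g y))"
    and integral_pair_distr: "(LINT (x, y)|(lborel \<Otimes>\<^sub>M lborel). h (f x, g y)) = (LINT z|(lborel \<Otimes>\<^sub>M lborel). h z)"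
proof -
  have [measurable]: "f \<in> borel_measurable borel" "g \<in> borel_measurable borel" using f g by auto
  have m: "(\<lambda>(x, y). (f x, g y)) \<in> lborel \<Otimes>\<^sub>M lborel \<rightarrow>\<^sub>M lborel \<Otimes>\<^sub>M lborel" by measurable
  have hm: "h \<in> borel_measurable (lborel \<Otimes>\<^sub>M lborel)" using h by auto
  show "integrable (lborel \<Otimes>\<^sub>M lborel) (\<lambda>(x, y). h (f x, g y))"
    using integrable_distr[OF m, of h] h lborel_pair_distr[OF f g] by (simp add: case_prod_beta')
  show "(LINT (x, y)|(lborel \<Otimes>\<^sub>M lborel). h (f x, g y)) = (LINT z|(lborel \<Otimes>\<^sub>M lborel). h z)"
    using integral_distr[OF m hm] lborel_pair_distr[OF f g] by (simp add: case_prod_beta')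
qed

lemma Lspace_bound:
  assumes "w \<in> Lspace q" "f \<in> borel_measurable borel" "\<And>x. \<bar>f x\<bar> \<le> L * \<bar>w x\<bar>" "0 \<le> q" "0 \<le> L"
  shows "f \<in> Lspace q"
proof -
  have "integrable lborel (\<lambda>x. L powr q * \<bar>w x\<bar> powr q)"
    using assms(1) by (auto simp: Lspace_def)
  then have "integrable lborel (\<lambda>x. \<bar>f x\<bar> powr q)"
  proof (rule Bochner_Integration.integrable_bound)
    show "AE x in lborel. norm (\<bar>f x\<bar> powr q) \<le> norm (L powr q * \<bar>w x\<bar> powr q)"
      using assms by (intro AE_I2) (auto simp: powr_mult[symmetric] intro!: powr_mono2)
  qed (use assms in measurable)
  with assms show ?thesis by (auto simp: Lspace_def)
qed

lemma Lspace_hrefl: "norm \<sigma> = 1 \<Longrightarrow> f \<in> Lspace q \<Longrightarrow> (\<lambda>x. f (hrefl \<sigma> l x)) \<in> Lspace q"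
  using integrable_hrefl[of \<sigma> "\<lambda>x. \<bar>f x\<bar> powr q" l] by (auto simp: Lspace_def)

lemma Lspace_diff:
  assumes "f \<in> Lspace q" "g \<in> Lspace q" "0 \<le> q"
  shows "(\<lambda>x. f x - g x) \<in> Lspace q"
proof -
  have [measurable]: "f \<in> borel_measurable borel" "g \<in> borel_measurable borel" using assms by (auto simp: Lspace_def)
  have "integrable lborel (\<lambda>x. 2 powr q * (\<bar>f x\<bar> powr q + \<bar>g x\<bar> powr q))"
    using assms by (auto simp: Lspace_def)
  then have "integrable lborel (\<lambda>x. \<bar>f x - g x\<bar> powr q)"
  proof (rule Bochner_Integration.integrable_bound)
    show "AE x in lborel. norm (\<bar>f x - g x\<bar> powr q) \<le> norm (2 powr q * (\<bar>f x\<bar> powr q + \<bar>g x\<bar> powr q))"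
      using abs_add_powr_le[OF assms(3), of "f _" "- g _"] by (intro AE_I2) auto
  qed measurable
  then show ?thesis by (auto simp: Lspace_def)
qed

lemma Lspace_1_iff: "f \<in> Lspace 1 \<longleftrightarrow> integrable lborel f"
  by (auto simp: Lspace_def integrable_abs_iff dest: borel_measurable_integrable)

lemma frac_Sobolev_D:
  fixes f :: "'a::euclidean_space \<Rightarrow> real"
  assumes "f \<in> frac_Sobolev s p"
  shows "f \<in> borel_measurable borel" "f \<in> Lspace p"
    "integrable (lborel \<Otimes>\<^sub>M lborel) (\<lambda>(x, y). \<bar>f x - f y\<bar> powr p / norm (x - y) powr (real DIM('a) + s * p))"
  using assms by (auto simp: frac_Sobolev_def Lspace_def)

lemma frac_Sobolev_hrefl:
  fixes f :: "'a::euclidean_space \<Rightarrow> real"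
  assumes s: "norm \<sigma> = 1" and f: "f \<in> frac_Sobolev s p"
  shows "(\<lambda>x. f (hrefl \<sigma> l x)) \<in> frac_Sobolev s p"
  using integrable_pair_distr[OF hrefl_measurable lborel_distr_hrefl[OF s] hrefl_measurable lborel_distr_hrefl[OF s] frac_Sobolev_D(3)[OF f], of l l]
    Lspace_hrefl[OF s frac_Sobolev_D(2)[OF f], of l]
  by (simp add: frac_Sobolev_def dist_hrefl[OF s])

lemma frac_Sobolev_diff:
  fixes f :: "'a::euclidean_space \<Rightarrow> real"
  assumes f: "f \<in> frac_Sobolev s p" and g: "g \<in> frac_Sobolev s p" and p: "0 \<le> p"
  shows "(\<lambda>x. f x - g x) \<in> frac_Sobolev s p"
proof -
  have [measurable]: "f \<in> borel_measurable borel" "g \<in> borel_measurable borel" using frac_Sobolev_D f g by auto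
  let ?k = "\<lambda>x y :: 'a. norm (x - y) powr (real DIM('a) + s * p)"
  have "integrable (lborel \<Otimes>\<^sub>M lborel) (\<lambda>z. 2 powr p * ((\<lambda>(x, y). \<bar>f x - f y\<bar> powr p / ?k x y) z + (\<lambda>(x, y). \<bar>g x - g y\<bar> powr p / ?k x y) z))"
    by (intro integrable_mult_right Bochner_Integration.integrable_add frac_Sobolev_D f g)
  then have "integrable (lborel \<Otimes>\<^sub>M lborel) (\<lambda>(x, y). \<bar>(f x - g x) - (f y - g y)\<bar> powr p / ?k x y)"
  proof (rule Bochner_Integration.integrable_bound)
    have "\<bar>(f x - g x) - (f y - g y)\<bar> powr p / ?k x y
       \<le> 2 powr p * (\<bar>f x - f y\<bar> powr p / ?k x y + \<bar>g x - g y\<bar> powr p / ?k x y)" for x y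
      using divide_right_mono[OF abs_add_powr_le[OF p, of "f x - f y" "- (g x - g y)"], of "?k x y"]
      unfolding abs_minus_cancel by (simp add: add_divide_distrib algebra_simps)
    then show "AE z in lborel \<Otimes>\<^sub>M lborel. norm (case z of (x, y) \<Rightarrow> \<bar>(f x - g x) - (f y - g y)\<bar> powr p / ?k x y)
       \<le> norm (2 powr p * ((\<lambda>(x, y). \<bar>f x - f y\<bar> powr p / ?k x y) z + (\<lambda>(x, y). \<bar>g x - g y\<bar> powr p / ?k x y) z))"
      by (intro AE_I2) (auto split: prod.split simp: abs_of_nonneg)
  qed measurable
  with Lspace_diff[OF frac_Sobolev_D(2)[OF f] frac_Sobolev_D(2)[OF g] p] show ?thesis
    by (simp add: frac_Sobolev_def)
qed

section \<open>Odd test functions and the energy form\<close>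

text \<open>
  The value of \<open>f\<close> at the outer point minus its value at the inner point of the pair formed by
  \<open>x\<close> and its mirror image. As a function on the whole space it is even under the reflection,
  so that its integrals need not be restricted to a half-space.
\<close>

definition refl_excess :: "'a::euclidean_space \<Rightarrow> real \<Rightarrow> ('a \<Rightarrow> real) \<Rightarrow> 'a \<Rightarrow> real" where
  "refl_excess \<sigma> l f x = (if x \<bullet> \<sigma> \<le> l then f (hrefl \<sigma> l x) - f x else f x - f (hrefl \<sigma> l x))"

text \<open>
  For \<open>\<eta> 0 = 0\<close> an odd function under the reflection. Testing the equation with it replaces a
  separate equation for the reflected solution.
\<close>

definition refl_test :: "'a::euclidean_space \<Rightarrow> real \<Rightarrow> (real \<Rightarrow> real) \<Rightarrow> ('a \<Rightarrow> real) \<Rightarrow> 'a \<Rightarrow> real" where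
  "refl_test \<sigma> l \<eta> f x = (if x \<bullet> \<sigma> \<le> l then - \<eta> (refl_excess \<sigma> l f x) else \<eta> (refl_excess \<sigma> l f x))"

lemma hrefl_fixed: "x \<bullet> \<sigma> = l \<Longrightarrow> hrefl \<sigma> l x = x"
  by (simp add: hrefl_def)

lemma refl_excess_hrefl: "norm \<sigma> = 1 \<Longrightarrow> refl_excess \<sigma> l f (hrefl \<sigma> l x) = refl_excess \<sigma> l f x"
  using hrefl_fixed[of x \<sigma> l] by (cases "x \<bullet> \<sigma> = l") (auto simp: refl_excess_def inner_hrefl)

lemma refl_test_hrefl:
  assumes "norm \<sigma> = 1" "\<eta> 0 = 0"
  shows "refl_test \<sigma> l \<eta> f (hrefl \<sigma> l x) = - refl_test \<sigma> l \<eta> f x"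
proof (cases "x \<bullet> \<sigma> = l")
  case True
  then show ?thesis using assms(2) by (simp add: refl_test_def refl_excess_def hrefl_fixed)
next
  case False
  then show ?thesis by (auto simp: refl_test_def refl_excess_hrefl[OF assms(1)] inner_hrefl[OF assms(1)])
qed

lemma refl_excess_measurable [measurable]:
  assumes [measurable]: "f \<in> borel_measurable borel"
  shows "refl_excess \<sigma> l f \<in> borel_measurable borel"
  unfolding refl_excess_def by measurable

lemma refl_test_measurable [measurable]:
  assumes [measurable]: "f \<in> borel_measurable borel" "\<eta> \<in> borel_measurable borel"
  shows "refl_test \<sigma> l \<eta> f \<in> borel_measurable borel"
  unfolding refl_test_def by measurable

text \<open>
  Cutting a function off along a hyperplane destroys fractional Sobolev regularity in general, but
  here \<open>w\<close> is odd under the reflection. If \<open>x\<close> and \<open>y\<close> lie on opposite sides, then \<open>w x\<close> is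
  compared both with \<open>w y\<close> and with the value \<open>- w y\<close> of \<open>w\<close> at the mirror image of \<open>y\<close>, and the
  latter point is at least as close to \<open>x\<close>, so that the kernel there is at least as large.
\<close>

lemma refl_test_difference_bound:
  fixes \<eta> :: "real \<Rightarrow> real"
  assumes \<eta>0: "\<And>r. r \<le> 0 \<Longrightarrow> \<eta> r = 0" and lip: "\<And>r t. \<bar>\<eta> r - \<eta> t\<bar> \<le> L * \<bar>r - t\<bar>"
    and L: "0 \<le> L" and s: "norm \<sigma> = 1"
    and w: "w = (\<lambda>x. f (hrefl \<sigma> l x) - f x)"
  shows "\<bar>refl_test \<sigma> l \<eta> f x - refl_test \<sigma> l \<eta> f y\<bar> \<le> L * \<bar>w x - w y\<bar>
    \<or> (norm (x - hrefl \<sigma> l y) \<le> norm (x - y) \<and>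
       \<bar>refl_test \<sigma> l \<eta> f x - refl_test \<sigma> l \<eta> f y\<bar> \<le> L * \<bar>w x - w y\<bar> + L * \<bar>w x - w (hrefl \<sigma> l y)\<bar>)"
proof -
  have wt: "w (hrefl \<sigma> l y) = - w y" for y using s by (simp add: w)
  have z: "refl_test \<sigma> l \<eta> f x = (if x \<bullet> \<sigma> \<le> l then - \<eta> (w x) else \<eta> (- w x))" for x
    by (simp add: refl_test_def refl_excess_def w)
  have \<eta>b: "\<bar>\<eta> r\<bar> \<le> L * max 0 r" for r
    using lip[of r 0] \<eta>0[of 0] \<eta>0[of r] by (auto simp: max_def)
  \<comment> \<open>For points on opposite sides the increment of the test function is, up to sign, a sum of two values of \<open>\<eta>\<close>.\<close>
  have opp: "\<bar>\<eta> r + \<eta> t\<bar> \<le> L * \<bar>r + t\<bar> + L * \<bar>r - t\<bar>" for r t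
  proof -
    have "\<bar>\<eta> r + \<eta> t\<bar> \<le> L * (max 0 r + max 0 t)" using \<eta>b[of r] \<eta>b[of t] by (simp add: algebra_simps)
    also have "\<dots> \<le> L * (\<bar>r + t\<bar> + \<bar>r - t\<bar>)" using L by (intro mult_left_mono) auto
    finally show ?thesis by (simp add: algebra_simps)
  qed
  consider "x \<bullet> \<sigma> \<le> l" "y \<bullet> \<sigma> \<le> l" | "\<not> x \<bullet> \<sigma> \<le> l" "\<not> y \<bullet> \<sigma> \<le> l"
    | "x \<bullet> \<sigma> \<le> l" "\<not> y \<bullet> \<sigma> \<le> l" | "\<not> x \<bullet> \<sigma> \<le> l" "y \<bullet> \<sigma> \<le> l" by blast
  then show ?thesis
  proof cases
    case 1 then show ?thesis using lip[of "w y" "w x"] by (auto simp: z abs_minus_commute)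
  next
    case 2 then show ?thesis using lip[of "- w x" "- w y"] by (auto simp: z abs_minus_commute)
  next
    case 3
    have "norm (x - hrefl \<sigma> l y) \<le> norm (x - hrefl \<sigma> l (hrefl \<sigma> l y))"
      using 3 s by (intro hrefl_closer) (auto simp: inner_hrefl)
    moreover have "\<bar>refl_test \<sigma> l \<eta> f x - refl_test \<sigma> l \<eta> f y\<bar> = \<bar>\<eta> (w x) + \<eta> (- w y)\<bar>"
      using 3 by (simp add: z)
    ultimately show ?thesis using opp[of "w x" "- w y"] s by (simp add: wt add.commute)
  next
    case 4
    have "norm (hrefl \<sigma> l x - y) \<le> norm (hrefl \<sigma> l x - hrefl \<sigma> l y)"
      using 4 s by (intro hrefl_closer) (auto simp: inner_hrefl)
    moreover have "norm (hrefl \<sigma> l x - y) = norm (x - hrefl \<sigma> l y)"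
      using dist_hrefl[OF s, of l "hrefl \<sigma> l x" y] s by simp
    moreover have "\<bar>refl_test \<sigma> l \<eta> f x - refl_test \<sigma> l \<eta> f y\<bar> = \<bar>\<eta> (- w x) + \<eta> (w y)\<bar>"
      using 4 by (simp add: z)
    ultimately show ?thesis using opp[of "- w x" "w y"] dist_hrefl[OF s, of l x y] by (simp add: wt abs_minus_commute add.commute)
  qed
qed

lemma refl_test_in_frac_Sobolev:
  fixes f :: "'a::euclidean_space \<Rightarrow> real"
  assumes \<eta>0: "\<And>r. r \<le> 0 \<Longrightarrow> \<eta> r = 0" and lip: "\<And>r t. \<bar>\<eta> r - \<eta> t\<bar> \<le> L * \<bar>r - t\<bar>"
    and \<eta>m: "\<eta> \<in> borel_measurable borel"
    and L: "0 \<le> L" and s: "norm \<sigma> = 1" and sp: "0 < s" "0 < p"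
    and f: "f \<in> frac_Sobolev s p \<inter> Lspace 2"
  shows "refl_test \<sigma> l \<eta> f \<in> frac_Sobolev s p \<inter> Lspace 2"
proof -
  define w where "w = (\<lambda>x. f (hrefl \<sigma> l x) - f x)"
  define \<zeta> where "\<zeta> = refl_test \<sigma> l \<eta> f"
  define q where "q = real DIM('a) + s * p"
  have q: "0 < q" using sp by (simp add: q_def add_pos_pos)
  have [measurable]: "f \<in> borel_measurable borel" using f frac_Sobolev_D by auto
  have \<zeta>m [measurable]: "\<zeta> \<in> borel_measurable borel" using \<eta>m unfolding \<zeta>_def by measurable
  have wW: "w \<in> frac_Sobolev s p"
    unfolding w_def using f s sp by (intro frac_Sobolev_diff frac_Sobolev_hrefl) auto
  have w2: "w \<in> Lspace 2" unfolding w_def using f s by (intro Lspace_diff Lspace_hrefl) auto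
  have \<zeta>b: "\<bar>\<zeta> x\<bar> \<le> L * \<bar>w x\<bar>" for x
    using lip[of "w x" 0] lip[of "- w x" 0] \<eta>0[of 0] abs_minus_commute[of "f x" "f (hrefl \<sigma> l x)"]
    by (auto simp: \<zeta>_def refl_test_def refl_excess_def w_def)
  have \<zeta>2: "\<zeta> \<in> Lspace 2" by (rule Lspace_bound[OF w2 \<zeta>m \<zeta>b]) (auto simp: L)
  have \<zeta>p: "\<zeta> \<in> Lspace p" by (rule Lspace_bound[OF frac_Sobolev_D(2)[OF wW] \<zeta>m \<zeta>b]) (use L sp in auto)
  define E where "E = (\<lambda>(x, y). \<bar>w x - w y\<bar> powr p / norm (x - y) powr q)"
  have E: "integrable (lborel \<Otimes>\<^sub>M lborel) E"
    using frac_Sobolev_D(3)[OF wW] by (simp add: E_def q_def)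
  have E': "integrable (lborel \<Otimes>\<^sub>M lborel) (\<lambda>(x, y). E (x, hrefl \<sigma> l y))"
    using integrable_pair_distr[OF _ _ hrefl_measurable lborel_distr_hrefl[OF s] E, of "\<lambda>x. x" l] distr_id2[of borel "lborel :: 'a measure"] by simp
  define C where "C = 2 powr p * L powr p"
  have bound: "\<bar>\<zeta> x - \<zeta> y\<bar> powr p / norm (x - y) powr q \<le> C * (E (x, y) + E (x, hrefl \<sigma> l y))" for x y
  proof -
    let ?a = "\<bar>w x - w y\<bar>" and ?b = "\<bar>w x - w (hrefl \<sigma> l y)\<bar>" and ?k = "norm (x - y) powr q" and ?k' = "norm (x - hrefl \<sigma> l y) powr q"
    have C1: "(L * a) powr p \<le> C * (a powr p)" if "0 \<le> a" for a
    proof -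
      have "(1::real) \<le> 2 powr p" using sp ge_one_powr_ge_zero[of 2 p] by simp
      from mult_right_mono[OF this, of "L powr p * a powr p"] show ?thesis
        using L that by (simp add: powr_mult C_def algebra_simps)
    qed
    have nn: "0 \<le> C" "0 \<le> E (x,y)" "0 \<le> E (x, hrefl \<sigma> l y)" by (auto simp: C_def E_def)
    from refl_test_difference_bound[where f=f and \<sigma>=\<sigma> and l=l and x=x and y=y and \<eta>=\<eta>, OF \<eta>0 lip L s w_def]
    show ?thesis unfolding \<zeta>_def[symmetric]
    proof
      assume "\<bar>\<zeta> x - \<zeta> y\<bar> \<le> L * ?a"
      then have "\<bar>\<zeta> x - \<zeta> y\<bar> powr p \<le> C * ?a powr p"
        using C1[of ?a] powr_mono2[of p "\<bar>\<zeta> x - \<zeta> y\<bar>" "L * ?a"] sp by auto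
      then have "\<bar>\<zeta> x - \<zeta> y\<bar> powr p / ?k \<le> C * E (x, y)"
        using divide_right_mono[of _ _ ?k] by (fastforce simp: E_def)
      also have "\<dots> \<le> C * (E (x, y) + E (x, hrefl \<sigma> l y))" using nn by (intro mult_left_mono) auto
      finally show ?thesis .
    next
      assume *: "norm (x - hrefl \<sigma> l y) \<le> norm (x - y) \<and> \<bar>\<zeta> x - \<zeta> y\<bar> \<le> L * ?a + L * ?b"
      have "\<bar>\<zeta> x - \<zeta> y\<bar> powr p \<le> \<bar>L * ?a + L * ?b\<bar> powr p"
        using * sp by (intro powr_mono2) auto
      also have "\<dots> \<le> 2 powr p * (\<bar>L * ?a\<bar> powr p + \<bar>L * ?b\<bar> powr p)"
        using sp by (intro abs_add_powr_le) auto
      also have "\<dots> = C * (?a powr p + ?b powr p)"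
        using L by (simp add: abs_mult powr_mult C_def algebra_simps)
      finally have "\<bar>\<zeta> x - \<zeta> y\<bar> powr p / ?k \<le> C * (?a powr p + ?b powr p) / ?k"
        by (intro divide_right_mono) auto
      also have "\<dots> = C * (?a powr p / ?k + ?b powr p / ?k)"
        by (simp only: times_divide_eq_right[symmetric] add_divide_distrib)
      also have "\<dots> \<le> C * (?a powr p / ?k + ?b powr p / ?k')"
      \<comment> \<open>At \<open>x = hrefl \<sigma> l y\<close> the divisor on the right is \<open>0\<close>, but so is the numerator.\<close>
      proof (cases "x = hrefl \<sigma> l y")
        case False
        then have "0 < ?k'" by simp
        moreover have "?k' \<le> ?k" using * q by (intro powr_mono2) auto
        ultimately have "0 < ?k * ?k'" "?k' \<le> ?k" by (metis less_le_trans mult_pos_pos, simp)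
        then have "?b powr p / ?k \<le> ?b powr p / ?k'" by (intro divide_left_mono) auto
        then show ?thesis using nn by (intro mult_left_mono) auto
      qed simp
      finally show ?thesis by (simp add: E_def)
    qed
  qed
  have "integrable (lborel \<Otimes>\<^sub>M lborel) (\<lambda>z. C * (E z + (\<lambda>(x, y). E (x, hrefl \<sigma> l y)) z))"
    by (intro integrable_mult_right Bochner_Integration.integrable_add E E')
  then have "integrable (lborel \<Otimes>\<^sub>M lborel) (\<lambda>(x, y). \<bar>\<zeta> x - \<zeta> y\<bar> powr p / norm (x - y) powr q)"
  proof (rule Bochner_Integration.integrable_bound)
    have "\<bar>\<bar>\<zeta> x - \<zeta> y\<bar> powr p / norm (x - y) powr q\<bar> \<le> \<bar>C * (E (x, y) + E (x, hrefl \<sigma> l y))\<bar>" for x y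
      using bound[of x y] by (metis abs_ge_self abs_of_nonneg divide_nonneg_nonneg order_trans powr_ge_zero)
    then show "AE z in lborel \<Otimes>\<^sub>M lborel. norm (case z of (x, y) \<Rightarrow> \<bar>\<zeta> x - \<zeta> y\<bar> powr p / norm (x - y) powr q)
       \<le> norm (C * (E z + (\<lambda>(x, y). E (x, hrefl \<sigma> l y)) z))"
      by (intro AE_I2) (auto split: prod.split)
  qed measurable
  then show ?thesis
    using \<zeta>2 \<zeta>p by (simp add: frac_Sobolev_def \<zeta>_def q_def)
qed

text \<open>
  Applying the reflection to neither, either or both of the variables leaves the integral
  unchanged, so the integrand may be replaced by the average over these four substitutions.
  That average is non-negative at every point: it is invariant under each of the substitutions,
  which reduces the claim to two points of the inner half-space, and there the sum of the four
  terms is the expression in \<open>four_point_ineq\<close>.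
\<close>

lemma energy_refl_test_nonneg:
  fixes f :: "'a::euclidean_space \<Rightarrow> real"
  assumes \<eta>0: "\<And>r. r \<le> 0 \<Longrightarrow> \<eta> r = 0" and mono: "mono \<eta>" and s: "norm \<sigma> = 1" and sp: "0 < s" "1 < p"
    and f: "f \<in> frac_Sobolev s p" and z: "refl_test \<sigma> l \<eta> f \<in> frac_Sobolev s p"
  shows "0 \<le> (LINT (x, y)|(lborel \<Otimes>\<^sub>M lborel). spow (f x - f y) (p - 1) *
      (refl_test \<sigma> l \<eta> f x - refl_test \<sigma> l \<eta> f y) / norm (x - y) powr (real DIM('a) + s * p))"
proof -
  define \<zeta> where "\<zeta> = refl_test \<sigma> l \<eta> f"
  define q where "q = real DIM('a) + s * p"
  have q: "0 < q" using sp by (simp add: q_def add_pos_pos)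
  define J where "J = (\<lambda>r. spow r (p - 1))"
  have J: "mono J" using sp by (auto simp: J_def intro!: monoI spow_mono)
  have Jm: "J (- r) = - J r" for r by (simp add: J_def spow_minus)
  have [measurable]: "f \<in> borel_measurable borel" "\<zeta> \<in> borel_measurable borel" "J \<in> borel_measurable borel"
    using f z frac_Sobolev_D by (auto simp: \<zeta>_def J_def)
  define \<tau> where "\<tau> = hrefl \<sigma> l"
  have tt: "\<tau> (\<tau> x) = x" for x using s by (simp add: \<tau>_def)
  have dt: "norm (\<tau> x - \<tau> y) = norm (x - y)" for x y using s by (simp add: \<tau>_def dist_hrefl)
  have dt': "norm (\<tau> x - y) = norm (x - \<tau> y)" for x y using dt[of x "\<tau> y"] by (simp add: tt)
  define G where "G = (\<lambda>(x, y). J (f x - f y) * (\<zeta> x - \<zeta> y) / norm (x - y) powr q)"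
  have G: "integrable (lborel \<Otimes>\<^sub>M lborel) G"
  proof (rule Bochner_Integration.integrable_bound)
    show "integrable (lborel \<Otimes>\<^sub>M lborel) (\<lambda>z. (\<lambda>(x, y). \<bar>f x - f y\<bar> powr p / norm (x - y) powr q) z
       + (\<lambda>(x, y). \<bar>\<zeta> x - \<zeta> y\<bar> powr p / norm (x - y) powr q) z)"
      using frac_Sobolev_D(3)[OF f] frac_Sobolev_D(3)[OF z] unfolding q_def \<zeta>_def
      by (rule Bochner_Integration.integrable_add)
    show "G \<in> borel_measurable (lborel \<Otimes>\<^sub>M lborel)" unfolding G_def by measurable
    have "\<bar>J (f x - f y) * (\<zeta> x - \<zeta> y) / norm (x - y) powr q\<bar>
       \<le> \<bar>f x - f y\<bar> powr p / norm (x - y) powr q + \<bar>\<zeta> x - \<zeta> y\<bar> powr p / norm (x - y) powr q" for x y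
    proof -
      have "\<bar>J (f x - f y) * (\<zeta> x - \<zeta> y)\<bar> = \<bar>f x - f y\<bar> powr (p - 1) * \<bar>\<zeta> x - \<zeta> y\<bar>"
        using sp by (simp add: abs_mult J_def abs_spow)
      also have "\<dots> \<le> \<bar>f x - f y\<bar> powr p + \<bar>\<zeta> x - \<zeta> y\<bar> powr p"
        using sp by (intro powr_mult_le_add) auto
      finally show ?thesis by (simp add: abs_divide add_divide_distrib[symmetric] divide_right_mono)
    qed
    then show "AE z in lborel \<Otimes>\<^sub>M lborel. norm (G z) \<le> norm ((\<lambda>(x, y). \<bar>f x - f y\<bar> powr p / norm (x - y) powr q) z
       + (\<lambda>(x, y). \<bar>\<zeta> x - \<zeta> y\<bar> powr p / norm (x - y) powr q) z)"
      unfolding G_def by (intro AE_I2) (auto split: prod.split)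
  qed
  have \<tau>m: "\<tau> \<in> borel_measurable borel" "distr lborel borel \<tau> = lborel"
    using lborel_distr_hrefl[OF s] by (auto simp: \<tau>_def)
  have im: "(\<lambda>x. x) \<in> borel_measurable borel" "distr lborel borel (\<lambda>x. x) = (lborel :: 'a measure)"
    using distr_id2[of borel "lborel :: 'a measure"] by auto
  note G1 = integrable_pair_distr[OF \<tau>m \<tau>m G] and I1 = integral_pair_distr[OF \<tau>m \<tau>m G]
  note G2 = integrable_pair_distr[OF im \<tau>m G] and I2 = integral_pair_distr[OF im \<tau>m G]
  note G3 = integrable_pair_distr[OF \<tau>m im G] and I3 = integral_pair_distr[OF \<tau>m im G]
  define S where "S = (\<lambda>x y. G (x, y) + G (\<tau> x, \<tau> y) + G (x, \<tau> y) + G (\<tau> x, y))"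
  have S1: "S (\<tau> x) y = S x y" and S2: "S x (\<tau> y) = S x y" for x y by (auto simp: S_def tt)
  have \<zeta>t: "\<zeta> (\<tau> x) = - \<zeta> x" for x unfolding \<zeta>_def \<tau>_def using s \<eta>0 by (intro refl_test_hrefl) auto
  have Sin: "0 \<le> S x y" if x: "x \<bullet> \<sigma> \<le> l" and y: "y \<bullet> \<sigma> \<le> l" for x y
  proof -
    have zx: "\<zeta> x = - \<eta> (f (\<tau> x) - f x)" and zy: "\<zeta> y = - \<eta> (f (\<tau> y) - f y)"
      using x y by (auto simp: \<zeta>_def refl_test_def refl_excess_def \<tau>_def)
    let ?K = "1 / norm (x - y) powr q" and ?K' = "1 / norm (x - \<tau> y) powr q"
    have KK: "f (\<tau> x) = f (\<tau> y) \<and> f x = f y \<or> ?K' \<le> ?K"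
    proof (cases "x = y")
      case False
      have "norm (x - y) \<le> norm (x - \<tau> y)" unfolding \<tau>_def using s x y by (intro hrefl_closer)
      moreover have "0 < norm (x - y)" using False by simp
      ultimately have "0 < norm (x - y)" "0 < norm (x - \<tau> y)" "norm (x - y) powr q \<le> norm (x - \<tau> y) powr q"
        using q by (auto intro: powr_mono2)
      then have "?K' \<le> ?K" by (intro divide_left_mono) auto
      then show ?thesis ..
    qed simp
    have 1: "J (f x - f (\<tau> y)) = - J (f (\<tau> y) - f x)" using Jm[of "f x - f (\<tau> y)"] by simp
    have "S x y = (J (f (\<tau> x) - f (\<tau> y)) - J (f x - f y)) * (\<eta> (f (\<tau> x) - f x) - \<eta> (f (\<tau> y) - f y)) * ?K
            + (J (f (\<tau> x) - f y) - J (f x - f (\<tau> y))) * (\<eta> (f (\<tau> x) - f x) + \<eta> (f (\<tau> y) - f y)) * ?K'"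
      unfolding S_def G_def by (simp add: dt dt' tt \<zeta>t zx zy diff_divide_distrib add_divide_distrib algebra_simps)
    also have "0 \<le> \<dots>"
      by (rule four_point_ineq[OF J mono \<eta>0 KK]) auto
    finally show ?thesis .
  qed
  have Snn: "0 \<le> S x y" for x y
  proof -
    define x' where "x' = (if x \<bullet> \<sigma> \<le> l then x else \<tau> x)"
    define y' where "y' = (if y \<bullet> \<sigma> \<le> l then y else \<tau> y)"
    have "S x y = S x' y'" using S1 S2 by (auto simp: x'_def y'_def)
    also have "0 \<le> \<dots>" by (rule Sin) (use s in \<open>auto simp: x'_def y'_def \<tau>_def inner_hrefl\<close>)
    finally show ?thesis .
  qed
  have "0 \<le> (LINT (x, y)|(lborel \<Otimes>\<^sub>M lborel). S x y)"
    by (intro integral_nonneg_AE AE_I2) (auto simp: Snn)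
  also have "\<dots> = (LINT z|(lborel \<Otimes>\<^sub>M lborel). (\<lambda>(x, y). G (x, y)) z + (\<lambda>(x, y). G (\<tau> x, \<tau> y)) z
        + (\<lambda>(x, y). G (x, \<tau> y)) z + (\<lambda>(x, y). G (\<tau> x, y)) z)"
    by (intro Bochner_Integration.integral_cong) (auto simp: S_def)
  also have "\<dots> = 4 * (LINT z|(lborel \<Otimes>\<^sub>M lborel). G z)"
    using G G1 G2 G3 I1 I2 I3 by (subst Bochner_Integration.integral_add; simp?)+
  finally show ?thesis by (simp add: G_def J_def \<zeta>_def q_def)
qed

section \<open>The reflection defect along the evolution\<close>

text \<open>
  For integrable \<open>f\<close> this vanishes exactly if \<open>f\<close> is almost everywhere at least as large at inner
  points as at their mirror images. The integral counts every pair of mirror images twice.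
\<close>

definition refl_defect :: "'a::euclidean_space \<Rightarrow> real \<Rightarrow> ('a \<Rightarrow> real) \<Rightarrow> real" where
  "refl_defect \<sigma> l f = (LINT x|lborel. max 0 (refl_excess \<sigma> l f x))"

lemma integrable_refl_excess:
  assumes s: "norm \<sigma> = 1" and f: "f \<in> Lspace 1"
  shows "integrable lborel (refl_excess \<sigma> l f)"
proof (rule Bochner_Integration.integrable_bound)
  have f: "integrable lborel f" using f by (simp add: Lspace_1_iff)
  then have [measurable]: "f \<in> borel_measurable borel" by auto
  show "integrable lborel (\<lambda>x. f (hrefl \<sigma> l x) - f x)"
    by (intro Bochner_Integration.integrable_diff integrable_hrefl s f)
  show "refl_excess \<sigma> l f \<in> borel_measurable lborel" by simp
qed (auto simp: refl_excess_def)

lemma integrable_max_0: "integrable M f \<Longrightarrow> integrable M (\<lambda>x. max 0 (f x :: real))"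
  by (rule Bochner_Integration.integrable_max) auto

lemma refl_defect_nonneg: "0 \<le> refl_defect \<sigma> l f"
  unfolding refl_defect_def by (intro integral_nonneg_AE) auto

lemma refl_defect_eq_0_iff:
  assumes s: "norm \<sigma> = 1" and f: "f \<in> Lspace 1"
  shows "refl_defect \<sigma> l f = 0 \<longleftrightarrow> (AE x in lborel. refl_excess \<sigma> l f x \<le> 0)"
proof -
  have "refl_defect \<sigma> l f = 0 \<longleftrightarrow> (AE x in lborel. max 0 (refl_excess \<sigma> l f x) = 0)"
    unfolding refl_defect_def
    by (intro integral_nonneg_eq_0_iff_AE integrable_max_0 integrable_refl_excess[OF assms]) auto
  moreover have "max 0 r = 0 \<longleftrightarrow> r \<le> 0" for r :: real by (auto simp: max_def)
  ultimately show ?thesis by simp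
qed

lemma refl_defect_le:
  assumes s: "norm \<sigma> = 1" and f: "f \<in> Lspace 1" and g: "g \<in> Lspace 1"
  shows "refl_defect \<sigma> l f \<le> refl_defect \<sigma> l g + 2 * L1_norm (\<lambda>x. f x - g x)"
proof -
  have d: "integrable lborel (\<lambda>x. \<bar>f x - g x\<bar>)" using f g by (simp add: Lspace_1_iff)
  then have [measurable]: "(\<lambda>x. \<bar>f x - g x\<bar>) \<in> borel_measurable borel" by auto
  have dt: "integrable lborel (\<lambda>x. \<bar>f (hrefl \<sigma> l x) - g (hrefl \<sigma> l x)\<bar>)"
    by (rule integrable_hrefl[OF s d])
  have "refl_defect \<sigma> l f \<le> (LINT x|lborel. max 0 (refl_excess \<sigma> l g x)
      + (\<bar>f x - g x\<bar> + \<bar>f (hrefl \<sigma> l x) - g (hrefl \<sigma> l x)\<bar>))"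
    unfolding refl_defect_def
    by (intro integral_mono integrable_max_0 integrable_refl_excess Bochner_Integration.integrable_add s f g d dt)
      (auto simp: refl_excess_def)
  also have "\<dots> = refl_defect \<sigma> l g + (L1_norm (\<lambda>x. f x - g x) + (LINT x|lborel. \<bar>f (hrefl \<sigma> l x) - g (hrefl \<sigma> l x)\<bar>))"
    unfolding refl_defect_def L1_norm_def
    by (subst Bochner_Integration.integral_add; (intro Bochner_Integration.integrable_add integrable_max_0 integrable_refl_excess s g d dt)?)+ simp
  also have "(LINT x|lborel. \<bar>f (hrefl \<sigma> l x) - g (hrefl \<sigma> l x)\<bar>) = L1_norm (\<lambda>x. f x - g x)"
    unfolding L1_norm_def by (rule integral_hrefl[OF s]) measurable
  finally show ?thesis by simp
qed

lemma refl_defect_AE_cong: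
  fixes f g :: "'a::euclidean_space \<Rightarrow> real"
  assumes s: "norm \<sigma> = 1" and f: "f \<in> Lspace 1" and g: "g \<in> Lspace 1" and e: "AE x in lborel. f x = g x"
  shows "refl_defect \<sigma> l f \<le> refl_defect \<sigma> l g"
proof -
  have "L1_norm (\<lambda>x. f x - g x) = (LINT x|(lborel :: 'a measure). 0)"
    unfolding L1_norm_def
  proof (rule Bochner_Integration.integral_cong_AE)
    show "(\<lambda>x. \<bar>f x - g x\<bar>) \<in> borel_measurable lborel" using f g by (auto simp: Lspace_def)
    show "AE x in lborel. \<bar>f x - g x\<bar> = 0" using e by eventually_elim simp
  qed simp
  then show ?thesis using refl_defect_le[OF s f g, of l] by simp
qed

text \<open>
  The defect is Lipschitz continuous in the norm of \<open>L\<^sup>1\<close>, hence every bound on it survives the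
  closure that defines the operator.
\<close>

lemma refl_defect_limit:
  assumes s: "norm \<sigma> = 1" and f: "\<And>k. F k \<in> Lspace 1" "f \<in> Lspace 1"
    and lim: "L1_tendsto F f A"
  shows "((\<lambda>k. refl_defect \<sigma> l (F k)) \<longlongrightarrow> refl_defect \<sigma> l f) A"
proof -
  have "((\<lambda>k. refl_defect \<sigma> l (F k) - refl_defect \<sigma> l f) \<longlongrightarrow> 0) A"
  proof (rule Lim_null_comparison)
    have "((\<lambda>k. 2 * L1_norm (\<lambda>x. F k x - f x)) \<longlongrightarrow> 2 * 0) A"
      using lim by (intro tendsto_mult_left) (simp add: L1_tendsto_def)
    then show "((\<lambda>k. 2 * L1_norm (\<lambda>x. F k x - f x)) \<longlongrightarrow> 0) A" by simp
    have "L1_norm (\<lambda>x. f x - F k x) = L1_norm (\<lambda>x. F k x - f x)" for k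
      by (simp add: L1_norm_def abs_minus_commute)
    then have "norm (refl_defect \<sigma> l (F k) - refl_defect \<sigma> l f) \<le> 2 * L1_norm (\<lambda>x. F k x - f x)" for k
      using refl_defect_le[OF s f(1)[of k] f(2), of l] refl_defect_le[OF s f(2) f(1)[of k], of l]
      by (simp add: abs_le_iff)
    then show "\<forall>\<^sub>F k in A. norm (refl_defect \<sigma> l (F k) - refl_defect \<sigma> l f) \<le> 2 * L1_norm (\<lambda>x. F k x - f x)"
      by simp
  qed
  then show ?thesis by (simp add: LIM_zero_iff)
qed

text \<open>
  Since the test function is odd, it only sees the odd part of \<open>u\<close>.
\<close>

lemma integral_mult_refl_test:
  fixes u :: "'a::euclidean_space \<Rightarrow> real"
  assumes s: "norm \<sigma> = 1" and u: "u \<in> Lspace 1" and \<eta>: "\<eta> 0 = 0" "\<eta> \<in> borel_measurable borel" "\<And>r. \<bar>\<eta> r\<bar> \<le> 1"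
    and f: "f \<in> borel_measurable borel"
  shows "integrable lborel (\<lambda>x. u x * refl_test \<sigma> l \<eta> f x)"
    and "2 * (LINT x|lborel. u x * refl_test \<sigma> l \<eta> f x)
       = (LINT x|lborel. refl_excess \<sigma> l u x * \<eta> (refl_excess \<sigma> l f x))"
proof -
  have [measurable]: "f \<in> borel_measurable borel" "\<eta> \<in> borel_measurable borel" by fact+
  have ui: "integrable lborel u" using u by (simp add: Lspace_1_iff)
  then have [measurable]: "u \<in> borel_measurable borel" by auto
  let ?z = "refl_test \<sigma> l \<eta> f" and ?t = "hrefl \<sigma> l"
  show i: "integrable lborel (\<lambda>x. u x * ?z x)"
  proof (rule Bochner_Integration.integrable_bound[OF ui])
    show "AE x in lborel. norm (u x * ?z x) \<le> norm (u x)"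
      using \<eta>(3) by (intro AE_I2) (auto simp: abs_mult refl_test_def intro!: mult_left_le)
  qed measurable
  have it: "integrable lborel (\<lambda>x. u (?t x) * ?z (?t x))" by (rule integrable_hrefl[OF s i])
  have "2 * (LINT x|lborel. u x * ?z x) = (LINT x|lborel. u x * ?z x) + (LINT x|lborel. u (?t x) * ?z (?t x))"
    by (subst integral_hrefl[OF s]) auto
  also have "\<dots> = (LINT x|lborel. u x * ?z x + u (?t x) * ?z (?t x))"
    using i it by simp
  also have "\<dots> = (LINT x|lborel. refl_excess \<sigma> l u x * \<eta> (refl_excess \<sigma> l f x))"
    unfolding refl_test_hrefl[where \<eta>=\<eta>, OF s \<eta>(1)]
    by (intro Bochner_Integration.integral_cong) (auto simp: refl_test_def refl_excess_def algebra_simps)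
  finally show "2 * (LINT x|lborel. u x * ?z x) = \<dots>" .
qed

text \<open>
  Lipschitz approximations of the indicator function of the positive half-line.
\<close>

definition ramp :: "nat \<Rightarrow> real \<Rightarrow> real" where "ramp n r = min 1 (max 0 (real n * r))"

lemma ramp_props:
  "r \<le> 0 \<Longrightarrow> ramp n r = 0" "mono (ramp n)" "\<bar>ramp n r - ramp n t\<bar> \<le> real n * \<bar>r - t\<bar>"
  "\<bar>ramp n r\<bar> \<le> 1" "0 \<le> ramp n r" "ramp n r \<le> 1"
proof -
  show "r \<le> 0 \<Longrightarrow> ramp n r = 0" using mult_nonneg_nonpos[of "real n" r] by (simp add: ramp_def)
  show "mono (ramp n)" unfolding ramp_def by (intro monoI min.mono max.mono mult_left_mono) auto
  have "\<bar>ramp n r - ramp n t\<bar> \<le> \<bar>real n * r - real n * t\<bar>" by (auto simp: ramp_def)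
  also have "\<dots> = real n * \<bar>r - t\<bar>" by (simp add: right_diff_distrib[symmetric] abs_mult)
  finally show "\<bar>ramp n r - ramp n t\<bar> \<le> real n * \<bar>r - t\<bar>" .
qed (auto simp: ramp_def)

lemma ramp_measurable [measurable]: "ramp n \<in> borel_measurable borel"
  unfolding ramp_def by measurable

text \<open>
  The equation is tested with the odd function built from \<open>ramp n\<close> and the excess of
  \<open>spow (u x) m\<close>. The energy term has a sign, and for \<open>n \<rightarrow> \<infinity>\<close> the remaining term on the left
  tends to the defect of \<open>u\<close>, because the excess of \<open>u\<close> and that of the increasing function
  \<open>spow (u x) m\<close> of \<open>u x\<close> have the same sign.
\<close>

lemma refl_defect_resolvent_regular:
  fixes u v :: "'a::euclidean_space \<Rightarrow> real"
  assumes s: "norm \<sigma> = 1" and sp: "0 < s" "1 < p" "0 < m" and h: "0 < h"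
    and u: "u \<in> Lspace 1" and A: "((\<lambda>x. spow (u x) m), v) \<in> frac_p_Laplacian_1inf s p"
  shows "refl_defect \<sigma> l u \<le> refl_defect \<sigma> l (\<lambda>x. u x + h * v x)"
proof -
  define f where "f = (\<lambda>x. spow (u x) m)"
  define g where "g = (\<lambda>x. u x + h * v x)"
  have fv: "f \<in> frac_Sobolev s p \<inter> Lspace 2" "v \<in> Lspace 1"
    and weak: "\<And>\<xi>. \<xi> \<in> frac_Sobolev s p \<inter> Lspace 2 \<Longrightarrow>
        (LINT x|lborel. v x * \<xi> x) =
        1 / 2 * (LINT (x, y)|(lborel \<Otimes>\<^sub>M lborel).
          spow (f x - f y) (p - 1) * (\<xi> x - \<xi> y) / norm (x - y) powr (real DIM('a) + s * p))"
    using A by (auto simp: frac_p_Laplacian_1inf_def frac_p_Laplacian_def f_def)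
  have [measurable]: "f \<in> borel_measurable borel" using fv frac_Sobolev_D by auto
  have ui: "integrable lborel u" and vi: "integrable lborel v" using u fv by (auto simp: Lspace_1_iff)
  then have [measurable]: "u \<in> borel_measurable borel" by auto
  have gi: "g \<in> Lspace 1" using ui vi by (simp add: Lspace_1_iff g_def)
  let ?Du = "refl_excess \<sigma> l u" and ?Df = "refl_excess \<sigma> l f" and ?Dg = "refl_excess \<sigma> l g"
  have Du: "integrable lborel ?Du" and Dg: "integrable lborel ?Dg"
    using s u gi by (auto intro: integrable_refl_excess)
  have le: "(LINT x|lborel. ?Du x * ramp n (?Df x)) \<le> refl_defect \<sigma> l g" for n
  proof -
    let ?z = "refl_test \<sigma> l (ramp n) f"
    have z: "?z \<in> frac_Sobolev s p \<inter> Lspace 2"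
      using s sp fv by (intro refl_test_in_frac_Sobolev[where L="real n"]) (auto simp: ramp_props)
    have "0 \<le> (LINT x|lborel. v x * ?z x)"
      unfolding weak[OF z] using s sp fv z
      by (intro mult_nonneg_nonneg energy_refl_test_nonneg) (auto simp: ramp_props)
    have I: "integrable lborel (\<lambda>x. u' x * ?z x)"
      "2 * (LINT x|lborel. u' x * ?z x) = (LINT x|lborel. refl_excess \<sigma> l u' x * ramp n (?Df x))"
      if "u' \<in> Lspace 1" for u'
      using integral_mult_refl_test[where \<eta>="ramp n" and f=f and \<sigma>=\<sigma> and l=l and u=u'] s that
      by (simp_all add: ramp_props)
    have Iu: "integrable lborel (\<lambda>x. u x * ?z x)" and Iv: "integrable lborel (\<lambda>x. v x * ?z x)"
      using I(1)[OF u] I(1)[OF fv(2)] by auto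
    have "(LINT x|lborel. ?Du x * ramp n (?Df x)) = 2 * (LINT x|lborel. u x * ?z x)"
      using I(2)[OF u] by simp
    also have "\<dots> \<le> 2 * ((LINT x|lborel. u x * ?z x) + h * (LINT x|lborel. v x * ?z x))"
      using h \<open>0 \<le> (LINT x|lborel. v x * ?z x)\<close> by simp
    also have "\<dots> = 2 * (LINT x|lborel. g x * ?z x)"
      using Iu Iv by (simp add: g_def distrib_right mult.assoc)
    also have "\<dots> = (LINT x|lborel. ?Dg x * ramp n (?Df x))"
      using I(2)[OF gi] by simp
    also have "\<dots> \<le> refl_defect \<sigma> l g"
      unfolding refl_defect_def
    proof (rule integral_mono)
      have [measurable]: "g \<in> borel_measurable borel" using gi by (auto simp: Lspace_def)
      show "integrable lborel (\<lambda>x. ?Dg x * ramp n (?Df x))"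
        by (rule Bochner_Integration.integrable_bound[OF Dg])
          (auto simp: abs_mult ramp_props intro!: mult_left_le)
      show "integrable lborel (\<lambda>x. max 0 (?Dg x))" by (rule integrable_max_0[OF Dg])
      show "?Dg x * ramp n (?Df x) \<le> max 0 (?Dg x)" for x
        using ramp_props(5,6)[of n "?Df x"]
        by (cases "?Dg x \<le> 0") (auto simp: mult_nonpos_nonneg mult_left_le max_def)
    qed
    finally show ?thesis .
  qed
  have "(\<lambda>n. LINT x|lborel. ?Du x * ramp n (?Df x)) \<longlonglongrightarrow> refl_defect \<sigma> l u"
    unfolding refl_defect_def
  proof (rule integral_dominated_convergence)
    show "integrable lborel (\<lambda>x. \<bar>?Du x\<bar>)" using Du by simp
    show "AE x in lborel. norm (?Du x * ramp n (?Df x)) \<le> \<bar>?Du x\<bar>" for n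
      by (auto simp: abs_mult ramp_props intro!: mult_left_le)
    have "(\<lambda>n. ?Du x * ramp n (?Df x)) \<longlonglongrightarrow> max 0 (?Du x)" for x
    proof (cases "0 < ?Du x")
      case True
      then have "0 < ?Df x"
        using spow_less[OF sp(3), of "u x" "u (hrefl \<sigma> l x)"] spow_less[OF sp(3), of "u (hrefl \<sigma> l x)" "u x"]
        by (auto simp: refl_excess_def f_def split: if_splits)
      then obtain N :: nat where N: "1 < real N * ?Df x" using reals_Archimedean3[of "?Df x"] by blast
      have "ramp n (?Df x) = 1" if "N \<le> n" for n
      proof -
        have "real N * ?Df x \<le> real n * ?Df x" using that \<open>0 < ?Df x\<close> by (intro mult_right_mono) auto
        then show ?thesis using N by (simp add: ramp_def)
      qed
      then have "\<forall>\<^sub>F n in sequentially. ?Du x * ramp n (?Df x) = max 0 (?Du x)"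
        using True by (auto simp: eventually_sequentially intro!: exI[of _ N])
      then show ?thesis by (rule tendsto_eventually)
    next
      case False
      then have "?Df x \<le> 0"
        using spow_mono[OF sp(3), of "u x" "u (hrefl \<sigma> l x)"] spow_mono[OF sp(3), of "u (hrefl \<sigma> l x)" "u x"]
        by (auto simp: refl_excess_def f_def split: if_splits)
      then show ?thesis using False by (simp add: ramp_props)
    qed
    then show "AE x in lborel. (\<lambda>n. ?Du x * ramp n (?Df x)) \<longlonglongrightarrow> max 0 (?Du x)" by simp
  qed measurable
  then show ?thesis unfolding g_def[symmetric] by (rule LIMSEQ_le_const2) (use le in auto)
qed

lemma refl_defect_resolvent:
  fixes u w :: "'a::euclidean_space \<Rightarrow> real"
  assumes s: "norm \<sigma> = 1" and sp: "0 < s" "1 < p" "0 < m" and h: "0 < h"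
    and A: "(u, w) \<in> A_op s p m"
  shows "refl_defect \<sigma> l u \<le> refl_defect \<sigma> l (\<lambda>x. u x + h * w x)"
proof -
  obtain U V where u: "u \<in> Lspace 1" "w \<in> Lspace 1"
    and U: "\<And>k. U k \<in> Lspace 1" and UV: "\<And>k. ((\<lambda>x. spow (U k x) m), V k) \<in> frac_p_Laplacian_1inf s p"
    and lim: "L1_tendsto U u sequentially" "L1_tendsto V w sequentially"
    using A by (auto simp: A_op_def)
  have V: "V k \<in> Lspace 1" for k using UV[of k] by (auto simp: frac_p_Laplacian_1inf_def)
  have 1: "(\<lambda>k. refl_defect \<sigma> l (U k)) \<longlonglongrightarrow> refl_defect \<sigma> l u"
    by (rule refl_defect_limit[OF s U u(1) lim(1)])
  have "L1_tendsto (\<lambda>k x. U k x + h * V k x) (\<lambda>x. u x + h * w x) sequentially"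
    unfolding L1_tendsto_def
  proof (rule Lim_null_comparison)
    have "(\<lambda>k. L1_norm (\<lambda>x. U k x - u x) + h * L1_norm (\<lambda>x. V k x - w x)) \<longlonglongrightarrow> 0 + h * 0"
      using lim by (intro tendsto_add tendsto_mult_left) (auto simp: L1_tendsto_def)
    then show "(\<lambda>k. L1_norm (\<lambda>x. U k x - u x) + h * L1_norm (\<lambda>x. V k x - w x)) \<longlonglongrightarrow> 0" by simp
    have "norm (L1_norm (\<lambda>x. U k x + h * V k x - (u x + h * w x)))
        \<le> L1_norm (\<lambda>x. U k x - u x) + h * L1_norm (\<lambda>x. V k x - w x)" for k
    proof -
      have i: "integrable lborel (U k)" "integrable lborel (V k)" "integrable lborel u" "integrable lborel w"
        using U V u by (auto simp: Lspace_1_iff)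
      have "L1_norm (\<lambda>x. U k x + h * V k x - (u x + h * w x))
         \<le> (LINT x|lborel. \<bar>U k x - u x\<bar> + h * \<bar>V k x - w x\<bar>)"
        unfolding L1_norm_def
      proof (rule integral_mono)
        fix x
        have "U k x + h * V k x - (u x + h * w x) = (U k x - u x) + h * (V k x - w x)"
          by (simp add: algebra_simps)
        then have "\<bar>U k x + h * V k x - (u x + h * w x)\<bar> \<le> \<bar>U k x - u x\<bar> + \<bar>h * (V k x - w x)\<bar>"
          by (metis abs_triangle_ineq)
        then show "\<bar>U k x + h * V k x - (u x + h * w x)\<bar> \<le> \<bar>U k x - u x\<bar> + h * \<bar>V k x - w x\<bar>"
          using h by (simp add: abs_mult)
      qed (use i in \<open>auto intro!: Bochner_Integration.integrable_add Bochner_Integration.integrable_diff\<close>)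
      also have "\<dots> = L1_norm (\<lambda>x. U k x - u x) + h * L1_norm (\<lambda>x. V k x - w x)"
        unfolding L1_norm_def using i by simp
      finally show ?thesis by (simp add: L1_norm_def)
    qed
    then show "\<forall>\<^sub>F k in sequentially. norm (L1_norm (\<lambda>x. U k x + h * V k x - (u x + h * w x)))
        \<le> L1_norm (\<lambda>x. U k x - u x) + h * L1_norm (\<lambda>x. V k x - w x)" by simp
  qed
  then have 2: "(\<lambda>k. refl_defect \<sigma> l (\<lambda>x. U k x + h * V k x)) \<longlonglongrightarrow> refl_defect \<sigma> l (\<lambda>x. u x + h * w x)"
    using U V u by (intro refl_defect_limit s) (auto simp: Lspace_1_iff)
  show ?thesis
    by (rule LIMSEQ_le[OF 1 2]) (use refl_defect_resolvent_regular[OF s sp h U UV] in auto)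
qed

lemma refl_defect_implicit_Euler:
  fixes u0 :: "'a::euclidean_space \<Rightarrow> real"
  assumes s: "norm \<sigma> = 1" and sp: "0 < s" "1 < p" "0 < m" and u0: "u0 \<in> Lspace 1"
    and E: "implicit_Euler s p m u0 T \<epsilon> N t U" and i: "i \<le> N"
  shows "U i \<in> Lspace 1 \<and> refl_defect \<sigma> l (U i) \<le> refl_defect \<sigma> l u0"
  using i
proof (induction i)
  case 0
  then show ?case using E u0 by (simp add: implicit_Euler_def)
next
  case (Suc i)
  then have i: "i < N" and IH: "U i \<in> Lspace 1" "refl_defect \<sigma> l (U i) \<le> refl_defect \<sigma> l u0" by auto
  then obtain w where h: "t i < t (Suc i)" and w: "(U (Suc i), w) \<in> A_op s p m"
    and ae: "AE x in lborel. U (Suc i) x + (t (Suc i) - t i) * w x = U i x"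
    using E by (auto simp: implicit_Euler_def)
  have U: "U (Suc i) \<in> Lspace 1" and wL: "w \<in> Lspace 1" using w by (auto simp: A_op_def)
  have "refl_defect \<sigma> l (U (Suc i)) \<le> refl_defect \<sigma> l (\<lambda>x. U (Suc i) x + (t (Suc i) - t i) * w x)"
    using h w by (intro refl_defect_resolvent[OF s sp]) auto
  also have "\<dots> \<le> refl_defect \<sigma> l (U i)"
    using U wL IH by (intro refl_defect_AE_cong[OF s] ae) (auto simp: Lspace_1_iff)
  finally show ?case using IH U by simp
qed

lemma step_fun_eq:
  assumes t: "\<And>i. i < N \<Longrightarrow> t i < t (Suc i)" and \<tau>: "t 0 \<le> \<tau>" "\<tau> < t N"
  obtains i where "i < N" "step_fun N t U \<tau> = U i"
proof -
  have lt: "i < j \<Longrightarrow> j \<le> N \<Longrightarrow> t i < t j" for i j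
  proof (induction j)
    case (Suc j)
    then show ?case using t[of j] by (cases "i = j") (auto intro: less_trans)
  qed simp
  define j where "j = (LEAST j. \<tau> < t j)"
  have j: "\<tau> < t j" unfolding j_def using \<tau>(2) by (rule LeastI)
  have jN: "j \<le> N" unfolding j_def using \<tau>(2) by (rule Least_le)
  have j0: "j \<noteq> 0" using j \<tau>(1) by (auto intro: ccontr)
  then obtain i where i: "j = Suc i" by (cases j) auto
  have "t i \<le> \<tau>" using not_less_Least[of i "\<lambda>j. \<tau> < t j"] i by (auto simp: j_def)
  have "(THE i. i < N \<and> t i \<le> \<tau> \<and> \<tau> < t (Suc i)) = i"
  proof (rule the_equality)
    show "i < N \<and> t i \<le> \<tau> \<and> \<tau> < t (Suc i)" using i j jN \<open>t i \<le> \<tau>\<close> by auto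
    fix k assume k: "k < N \<and> t k \<le> \<tau> \<and> \<tau> < t (Suc k)"
    have "\<not> Suc k \<le> i" using k \<open>t i \<le> \<tau>\<close> lt[of "Suc k" i] i jN by (cases "Suc k = i") auto
    moreover have "\<not> Suc i \<le> k" using k j i lt[of "Suc i" k] by (cases "Suc i = k") auto
    ultimately show "k = i" by simp
  qed
  then show ?thesis using that[of i] i jN by (simp add: step_fun_def)
qed

lemma refl_defect_mild_solution:
  fixes u0 :: "'a::euclidean_space \<Rightarrow> real"
  assumes s: "norm \<sigma> = 1" and sp: "0 < s" "1 < p" "0 < m" and u0: "u0 \<in> Lspace 1"
    and u: "mild_solution s p m u0 u" and \<tau>: "0 \<le> \<tau>"
  shows "refl_defect \<sigma> l (u \<tau>) \<le> refl_defect \<sigma> l u0"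
proof (rule field_le_epsilon)
  fix e :: real assume e: "0 < e"
  have ut: "u \<tau> \<in> Lspace 1" using u \<tau> by (auto simp: mild_solution_def)
  have "0 < \<tau> + 1" using \<tau> by simp
  with u have "\<exists>N t U. (\<forall>\<epsilon>>0. implicit_Euler s p m u0 (\<tau> + 1) \<epsilon> (N \<epsilon>) (t \<epsilon>) (U \<epsilon>)) \<and>
        (\<forall>\<delta>>0. \<forall>\<^sub>F \<epsilon> in at_right 0. \<forall>\<tau>'\<in>{0..<\<tau> + 1}.
           L1_norm (\<lambda>x. step_fun (N \<epsilon>) (t \<epsilon>) (U \<epsilon>) \<tau>' x - u \<tau>' x) < \<delta>)"
    unfolding mild_solution_def by blast
  then obtain N t U where E: "\<And>\<epsilon>. 0 < \<epsilon> \<Longrightarrow> implicit_Euler s p m u0 (\<tau> + 1) \<epsilon> (N \<epsilon>) (t \<epsilon>) (U \<epsilon>)"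
    and C: "\<And>\<delta>. 0 < \<delta> \<Longrightarrow> \<forall>\<^sub>F \<epsilon> in at_right 0. \<forall>\<tau>'\<in>{0..<\<tau> + 1}.
           L1_norm (\<lambda>x. step_fun (N \<epsilon>) (t \<epsilon>) (U \<epsilon>) \<tau>' x - u \<tau>' x) < \<delta>"
    by blast
  have "\<forall>\<^sub>F \<epsilon> in at_right (0::real). 0 < \<epsilon>" by (rule eventually_at_right_less)
  with C[of "e / 2"] e have "\<forall>\<^sub>F \<epsilon> in at_right 0. 0 < \<epsilon> \<and> (\<forall>\<tau>'\<in>{0..<\<tau> + 1}.
           L1_norm (\<lambda>x. step_fun (N \<epsilon>) (t \<epsilon>) (U \<epsilon>) \<tau>' x - u \<tau>' x) < e / 2)"
    by (intro eventually_conj) auto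
  then have "\<exists>\<epsilon>. 0 < \<epsilon> \<and> (\<forall>\<tau>'\<in>{0..<\<tau> + 1}.
           L1_norm (\<lambda>x. step_fun (N \<epsilon>) (t \<epsilon>) (U \<epsilon>) \<tau>' x - u \<tau>' x) < e / 2)"
    by (rule eventually_happens'[rotated]) simp
  then obtain \<epsilon> where \<epsilon>: "0 < \<epsilon>" and c: "L1_norm (\<lambda>x. step_fun (N \<epsilon>) (t \<epsilon>) (U \<epsilon>) \<tau> x - u \<tau> x) < e / 2"
    using \<tau> by (meson atLeastLessThan_iff less_add_one)
  note E = E[OF \<epsilon>]
  obtain i where i: "i < N \<epsilon>" "step_fun (N \<epsilon>) (t \<epsilon>) (U \<epsilon>) \<tau> = U \<epsilon> i"
    using E \<tau> by (auto simp: implicit_Euler_def intro: step_fun_eq[of "N \<epsilon>" "t \<epsilon>" \<tau> "U \<epsilon>"])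
  have Ui: "U \<epsilon> i \<in> Lspace 1" "refl_defect \<sigma> l (U \<epsilon> i) \<le> refl_defect \<sigma> l u0"
    using refl_defect_implicit_Euler[OF s sp u0 E, of i] i by auto
  have "L1_norm (\<lambda>x. u \<tau> x - U \<epsilon> i x) < e / 2"
    using c i by (simp add: L1_norm_def abs_minus_commute)
  then show "refl_defect \<sigma> l (u \<tau>) \<le> refl_defect \<sigma> l u0 + e"
    using refl_defect_le[OF s ut Ui(1), of l] Ui(2) by simp
qed

section \<open>From reflections to radial monotonicity\<close>

text \<open>
  A form of the Lebesgue density theorem: almost every point outside \<open>Z\<close> is a point of density
  zero of \<open>Z\<close>. The cubes have the point as a corner, not as the centre.
\<close>

lemma density_cubes:
  fixes Z :: "'a::euclidean_space set"
  assumes Z: "Z \<in> sets borel"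
  shows "\<exists>N. negligible N \<and> (\<forall>x. x \<notin> N \<longrightarrow> x \<notin> Z \<longrightarrow> (\<forall>e>0. \<exists>d>0. \<forall>h. 0 < h \<and> h < d \<longrightarrow>
     measure lborel (Z \<inter> cbox x (x + h *\<^sub>R One)) < e * h ^ DIM('a)))"
proof -
  have lm: "Z \<inter> cbox a b \<in> lmeasurable" for a b
    using Z by (intro bounded_set_imp_lmeasurable) (auto intro: bounded_subset[OF bounded_cbox])
  have "indicat_real Z integrable_on cbox a b" for a b
    using lm by (simp add: integrable_on_indicator)
  from integrable_ccontinuous_explicit[OF this] obtain N where N: "negligible N"
    and lim: "\<And>x e. \<lbrakk>x \<notin> N; 0 < e\<rbrakk> \<Longrightarrow> \<exists>d>0. \<forall>h. 0 < h \<and> h < d \<longrightarrow>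
       norm (integral (cbox x (x + h *\<^sub>R One)) (indicat_real Z) /\<^sub>R h ^ DIM('a) - indicat_real Z x) < e" by metis
  have "measure lborel (Z \<inter> cbox x (x + h *\<^sub>R One)) < e * h ^ DIM('a)"
    if "norm (integral (cbox x (x + h *\<^sub>R One)) (indicat_real Z) /\<^sub>R h ^ DIM('a) - indicat_real Z x) < e" "x \<notin> Z" "0 < h"
    for x h e
  proof -
    have "integral (cbox x (x + h *\<^sub>R One)) (indicat_real Z) = measure lborel (Z \<inter> cbox x (x + h *\<^sub>R One))"
      using Z by (subst Equivalence_Lebesgue_Henstock_Integration.integral_indicator[OF lm]) (auto simp: measure_completion)
    then show ?thesis using that by (simp add: divide_simps abs_less_iff mult.commute)
  qed
  then have "\<forall>x. x \<notin> N \<longrightarrow> x \<notin> Z \<longrightarrow> (\<forall>e>0. \<exists>d>0. \<forall>h. 0 < h \<and> h < d \<longrightarrow>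
     measure lborel (Z \<inter> cbox x (x + h *\<^sub>R One)) < e * h ^ DIM('a))"
    using lim by meson
  with N show ?thesis by blast
qed

lemma ball_subset_cube:
  fixes x :: "'a::euclidean_space"
  shows "ball (x + (h/2) *\<^sub>R One) (h/2) \<subseteq> cbox x (x + h *\<^sub>R One)"
proof
  fix z assume "z \<in> ball (x + (h/2) *\<^sub>R One) (h/2)"
  then have n: "norm (x + (h/2) *\<^sub>R One - z) < h / 2" by (simp add: dist_norm)
  show "z \<in> cbox x (x + h *\<^sub>R One)"
    unfolding mem_box
  proof (intro ballI)
    fix i :: 'a assume i: "i \<in> Basis"
    have "\<bar>(x + (h/2) *\<^sub>R One - z) \<bullet> i\<bar> < h / 2" using n Basis_le_norm[OF i] by (rule le_less_trans[rotated])
    then show "x \<bullet> i \<le> z \<bullet> i \<and> z \<bullet> i \<le> (x + h *\<^sub>R One) \<bullet> i"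
      using i unfolding inner_diff_left inner_add_left abs_less_iff by simp
  qed
qed

lemma measure_Int_ball_le_cube:
  fixes x :: "'a::euclidean_space"
  assumes "Z \<in> sets borel"
  shows "measure lborel (Z \<inter> ball (x + (h/2) *\<^sub>R One) (h/2)) \<le> measure lborel (Z \<inter> cbox x (x + h *\<^sub>R One))"
proof (rule measure_mono_fmeasurable)
  show "Z \<inter> ball (x + (h/2) *\<^sub>R One) (h/2) \<subseteq> Z \<inter> cbox x (x + h *\<^sub>R One)"
    using ball_subset_cube by blast
  show "Z \<inter> ball (x + (h/2) *\<^sub>R One) (h/2) \<in> sets lborel" using assms by simp
  have "cbox x (x + h *\<^sub>R One) \<in> fmeasurable lborel"
    using emeasure_lborel_cbox_finite[of x "x + h *\<^sub>R One"] by (simp add: fmeasurable_def)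
  then show "Z \<inter> cbox x (x + h *\<^sub>R One) \<in> fmeasurable lborel"
    by (rule fmeasurableI2) (use assms in auto)
qed

text \<open>
  For \<open>x \<noteq> y\<close> and the unit vector \<open>\<sigma>\<close> from \<open>x\<close> to \<open>y\<close> this says that the hyperplane
  \<open>z \<bullet> \<sigma> = l\<close> bisecting \<open>x\<close> and \<open>y\<close> has \<open>l > R\<close>, because
  \<open>l = ((norm y)\<^sup>2 - (norm x)\<^sup>2) / (2 * norm (y - x))\<close>. The inequality is strict so that it
  also holds for nearby pairs.
\<close>

definition beyond :: "real \<Rightarrow> 'a::euclidean_space \<Rightarrow> 'a \<Rightarrow> bool" where
  "beyond R x y \<longleftrightarrow> 2 * R * norm (y - x) < (norm y)\<^sup>2 - (norm x)\<^sup>2"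

text \<open>
  The hypotheses on \<open>x\<close> and \<open>y\<close> say that \<open>f x < q < f y\<close> in the sense of density. Take small balls
  of equal radius, contained in the cubes at \<open>x\<close> and \<open>y\<close>, that are mirror images of each other in
  a hyperplane. Most points of the first have \<open>f < q\<close> and most points of the second have
  \<open>f > q\<close>, so on a set of positive measure in the first ball the value of \<open>f\<close> is smaller than at
  the mirror image.
\<close>

lemma beyond_density_contradiction:
  fixes f :: "'a::euclidean_space \<Rightarrow> real"
  assumes f[measurable]: "f \<in> borel_measurable borel"
    and H: "\<And>\<sigma> l. norm \<sigma> = 1 \<Longrightarrow> R \<le> l \<Longrightarrow> AE z in lborel. z \<bullet> \<sigma> \<le> l \<longrightarrow> f (hrefl \<sigma> l z) \<le> f z"
    and xy: "beyond R x y"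
    and x: "\<And>e. 0 < e \<Longrightarrow> \<exists>d>0. \<forall>h. 0 < h \<and> h < d \<longrightarrow>
        measure lborel ({z. q \<le> f z} \<inter> cbox x (x + h *\<^sub>R One)) < e * h ^ DIM('a)"
    and y: "\<And>e. 0 < e \<Longrightarrow> \<exists>d>0. \<forall>h. 0 < h \<and> h < d \<longrightarrow>
        measure lborel ({z. f z \<le> q} \<inter> cbox y (y + h *\<^sub>R One)) < e * h ^ DIM('a)"
  shows False
proof -
  define n where "n = norm (y - x)"
  have "x \<noteq> y" using xy by (auto simp: beyond_def)
  then have n: "0 < n" by (simp add: n_def)
  define \<sigma> where "\<sigma> = (1 / n) *\<^sub>R (y - x)"
  have s: "norm \<sigma> = 1" using n by (simp add: \<sigma>_def n_def[symmetric])
  then have ss: "\<sigma> \<bullet> \<sigma> = 1" by (simp add: norm_eq_1)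
  have yx: "y = x + n *\<^sub>R \<sigma>" using n by (simp add: \<sigma>_def)
  \<comment> \<open>The hyperplane at height \<open>l h\<close> bisects the centres of the cubes of side \<open>h\<close>.\<close>
  define l where "l h = x \<bullet> \<sigma> + n / 2 + (h / 2) * (One \<bullet> \<sigma>)" for h
  have "(norm y)\<^sup>2 - (norm x)\<^sup>2 = 2 * n * l 0"
    unfolding yx power2_norm_eq_inner l_def using ss by (simp add: inner_commute algebra_simps)
  with xy n have "R < l 0" by (simp add: beyond_def n_def[symmetric] mult.commute)
  have "(l \<longlongrightarrow> l 0) (at_right 0)" unfolding l_def by (auto intro!: tendsto_eq_intros)
  then have e1: "\<forall>\<^sub>F h in at_right 0. R < l h" using \<open>R < l 0\<close> by (rule order_tendstoD)
  \<comment> \<open>The constant is chosen so that a ball of radius \<open>h / 2\<close> has measure \<open>V * h ^ DIM('a)\<close>.\<close>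
  define V where "V = unit_ball_vol (real DIM('a)) / 2 ^ DIM('a)"
  have V: "0 < V" by (simp add: V_def)
  have "0 < V / 2" using V by simp
  from x[OF this] y[OF this]
  obtain d1 d2 where d: "0 < d1" "0 < d2"
    and x1: "\<And>h. 0 < h \<Longrightarrow> h < d1 \<Longrightarrow> measure lborel ({z. q \<le> f z} \<inter> cbox x (x + h *\<^sub>R One)) < V / 2 * h ^ DIM('a)"
    and y1: "\<And>h. 0 < h \<Longrightarrow> h < d2 \<Longrightarrow> measure lborel ({z. f z \<le> q} \<inter> cbox y (y + h *\<^sub>R One)) < V / 2 * h ^ DIM('a)"
    by blast
  have "\<forall>\<^sub>F h in at_right 0. 0 < h \<and> h < min n (min d1 d2)"
    using n d by (auto simp: eventually_at_right_field intro!: exI[of _ "min n (min d1 d2)"])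
  with e1 have "\<forall>\<^sub>F h in at_right 0. R < l h \<and> 0 < h \<and> h < min n (min d1 d2)" by eventually_elim auto
  then have "\<exists>h. R < l h \<and> 0 < h \<and> h < min n (min d1 d2)" by (rule eventually_happens'[rotated]) simp
  then obtain h where h: "R < l h" "0 < h" "h < n" "h < d1" "h < d2" by auto
  define \<tau> where "\<tau> = hrefl \<sigma> (l h)"
  have [measurable]: "\<tau> \<in> borel_measurable borel" by (simp add: \<tau>_def)
  define c where "c = x + (h / 2) *\<^sub>R One"
  define c' where "c' = y + (h / 2) *\<^sub>R One"
  define B where "B = ball c (h / 2)"
  define B' where "B' = ball c' (h / 2)"
  have B[measurable]: "B \<in> sets borel" "B' \<in> sets borel" by (auto simp: B_def B'_def)
  have "\<tau> c = c'"
    unfolding \<tau>_def hrefl_def c_def c'_def l_def yx by (simp add: inner_add_left)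
  then have \<tau>B: "\<tau> z \<in> B'" if "z \<in> B" for z
    using that dist_hrefl[OF s, of "l h" c z] by (simp add: B_def B'_def dist_norm \<tau>_def)
  have Bl: "z \<bullet> \<sigma> \<le> l h" if "z \<in> B" for z
  proof -
    have "\<bar>(z - c) \<bullet> \<sigma>\<bar> \<le> norm (z - c) * norm \<sigma>" by (rule Cauchy_Schwarz_ineq2)
    then have "z \<bullet> \<sigma> \<le> c \<bullet> \<sigma> + h / 2"
      using that s by (simp add: inner_diff_left B_def dist_norm norm_minus_commute abs_le_iff)
    then show ?thesis using h by (simp add: l_def c_def inner_add_left)
  qed
  define E where "E = {z. q \<le> f z} \<inter> B"
  define F where "F = {z. f z \<le> q} \<inter> B'"
  have [measurable]: "E \<in> sets borel" "F \<in> sets borel"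
    by (simp_all add: E_def F_def)
  have finB: "emeasure lborel B < \<infinity>" "emeasure lborel B' < \<infinity>"
    unfolding B_def B'_def by (rule emeasure_lborel_ball_finite)+
  have fE: "E \<in> fmeasurable lborel" and fF: "F \<in> fmeasurable lborel"
    using finB by (auto simp: fmeasurable_def E_def F_def intro: le_less_trans[OF emeasure_mono])
  have fF': "(\<tau> -` F) \<in> fmeasurable lborel" and mF': "measure lborel (\<tau> -` F) = measure lborel F"
  proof -
    have "emeasure lborel (\<tau> -` F) = emeasure (distr lborel borel \<tau>) F"
      by (simp add: emeasure_distr)
    then have e: "emeasure lborel (\<tau> -` F) = emeasure lborel F"
      by (simp add: \<tau>_def lborel_distr_hrefl[OF s])
    then show "measure lborel (\<tau> -` F) = measure lborel F" by (simp add: measure_def)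
    have "\<tau> -` F \<in> sets borel" using measurable_sets[of \<tau> borel borel F] by simp
    with e fF show "(\<tau> -` F) \<in> fmeasurable lborel" by (simp add: fmeasurable_def)
  qed
  have AE: "AE z in lborel. z \<in> B \<longrightarrow> z \<in> E \<union> \<tau> -` F"
    using H[OF s less_imp_le[OF h(1)]]
  proof eventually_elim
    case (elim z)
    then show ?case using Bl[of z] \<tau>B[of z] by (auto simp: E_def F_def \<tau>_def)
  qed
  have "V * h ^ DIM('a) = measure lborel B"
    using h by (simp add: B_def V_def content_ball power_divide)
  also have "\<dots> \<le> measure lborel (E \<union> \<tau> -` F)"
    unfolding measure_def
  proof (rule enn2real_mono)
    show "emeasure lborel B \<le> emeasure lborel (E \<union> \<tau> -` F)"
      by (rule emeasure_mono_AE[OF AE fmeasurableD[OF fmeasurable.Un[OF fE fF']]])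
    show "emeasure lborel (E \<union> \<tau> -` F) < top"
      using fmeasurable.Un[OF fE fF'] by (simp add: fmeasurable_def)
  qed
  also have "\<dots> \<le> measure lborel E + measure lborel F"
    using measure_Un_le[OF fmeasurableD[OF fE] fmeasurableD[OF fF']] mF' by simp
  also have "measure lborel E \<le> measure lborel ({z. q \<le> f z} \<inter> cbox x (x + h *\<^sub>R One))"
    unfolding E_def B_def c_def by (rule measure_Int_ball_le_cube) measurable
  also have "measure lborel F \<le> measure lborel ({z. f z \<le> q} \<inter> cbox y (y + h *\<^sub>R One))"
    unfolding F_def B'_def c'_def by (rule measure_Int_ball_le_cube) measurable
  finally show False using x1[of h] y1[of h] h by simp
qed

lemma beyond_trans: "0 \<le> R \<Longrightarrow> beyond R x y \<Longrightarrow> beyond R y z \<Longrightarrow> beyond R x z"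
proof -
  assume R: "0 \<le> R" and 1: "beyond R x y" "beyond R y z"
  have "norm (z - x) \<le> norm (z - y) + norm (y - x)" using norm_triangle_ineq[of "z - y" "y - x"] by simp
  from mult_left_mono[OF this, of "2 * R"] R 1 show ?thesis by (simp add: beyond_def algebra_simps)
qed

lemma beyond_scaleR:
  assumes "norm \<sigma> = 1" "0 \<le> r" "r < r'" "2 * R < r + r'"
  shows "beyond R (r *\<^sub>R \<sigma>) (r' *\<^sub>R \<sigma>)"
proof -
  have "norm (r' *\<^sub>R \<sigma> - r *\<^sub>R \<sigma>) = r' - r" using assms by (simp add: scaleR_diff_left[symmetric])
  moreover have "2 * R * (r' - r) < (r + r') * (r' - r)" using assms by (intro mult_strict_right_mono) auto
  moreover have "(norm (r' *\<^sub>R \<sigma>))\<^sup>2 - (norm (r *\<^sub>R \<sigma>))\<^sup>2 = (r + r') * (r' - r)"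
    using assms by (simp add: power2_eq_square algebra_simps)
  ultimately show ?thesis unfolding beyond_def by simp
qed

text \<open>
  Each single reflection gives an inequality off a null set that depends on the reflection. The
  density theorem, applied to the level sets of \<open>f\<close> at all rational heights, gives one null set
  \<open>N\<close> such that \<open>f y \<le> f x\<close> for all \<open>x\<close> and \<open>y\<close> outside \<open>N\<close> with \<open>y\<close> beyond \<open>x\<close>. Being
  beyond is a transitive relation. The representative at \<open>x\<close> is the supremum of \<open>f\<close> over the points
  outside \<open>N\<close> that are equal to or beyond \<open>x\<close>; it is monotone along rays by inclusion of these sets.
\<close>

lemma radially_decreasing_beyond_if_reflections:
  fixes f :: "'a::euclidean_space \<Rightarrow> real"
  assumes f[measurable]: "f \<in> borel_measurable borel" and R: "0 \<le> R'" "R' < R"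
    and H: "\<And>\<sigma> l. norm \<sigma> = 1 \<Longrightarrow> R' \<le> l \<Longrightarrow> AE z in lborel. z \<bullet> \<sigma> \<le> l \<longrightarrow> f (hrefl \<sigma> l z) \<le> f z"
  shows "radially_decreasing_beyond R f"
proof -
  define dens where "dens Z N \<longleftrightarrow> (\<forall>x. x \<notin> N \<longrightarrow> x \<notin> Z \<longrightarrow> (\<forall>e>0. \<exists>d>0. \<forall>h. 0 < h \<and> h < d \<longrightarrow>
     measure lborel (Z \<inter> cbox x (x + h *\<^sub>R One)) < e * h ^ DIM('a)))" for Z N :: "'a set"
  have "\<forall>q. \<exists>N. negligible N \<and> dens {z. q \<le> f z} N"
    unfolding dens_def by (intro allI density_cubes) measurable
  then obtain N1 where N1: "\<And>q. negligible (N1 q)" "\<And>q. dens {z. q \<le> f z} (N1 q)" by metis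
  have "\<forall>q. \<exists>N. negligible N \<and> dens {z. f z \<le> q} N"
    unfolding dens_def by (intro allI density_cubes) measurable
  then obtain N2 where N2: "\<And>q. negligible (N2 q)" "\<And>q. dens {z. f z \<le> q} (N2 q)" by metis
  define N where "N = (\<Union>q\<in>\<rat>. N1 q \<union> N2 q)"
  have N: "negligible N" unfolding N_def using N1 N2 by (intro negligible_countable_Union) (auto simp: countable_rat)
  have D: "f y \<le> f x" if "x \<notin> N" "y \<notin> N" "beyond R' x y" for x y
  proof (rule ccontr)
    assume "\<not> f y \<le> f x"
    then obtain q where q: "q \<in> \<rat>" "f x < q" "q < f y" using Rats_dense_in_real[of "f x" "f y"] by auto
    show False
      by (rule beyond_density_contradiction[OF f H that(3), of q])
        (use N1(2)[of q] N2(2)[of q] q that in \<open>auto simp: dens_def N_def\<close>)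
  qed
  have meets: "\<exists>y. y \<notin> N \<and> y \<in> W" if "open W" "W \<noteq> {}" for W
    using open_not_negligible[OF that] negligible_subset[OF N, of W] by blast
  have op1: "open {y. beyond R' x y}" and op2: "open {y. beyond R' y x}" for x :: 'a
    unfolding beyond_def by (intro open_Collect_less continuous_intros)+
  define S where "S x = {f y | y. y \<notin> N \<and> (y = x \<or> beyond R' x y)}" for x
  have S: "S x \<noteq> {}" "bdd_above (S x)" if x: "R \<le> norm x" for x
  proof -
    define r where "r = norm x"
    define \<sigma> where "\<sigma> = (1 / r) *\<^sub>R x"
    have r: "R \<le> r" "0 < r" using x R by (auto simp: r_def)
    have s: "norm \<sigma> = 1" "x = r *\<^sub>R \<sigma>" using r by (auto simp: \<sigma>_def) (simp add: r_def[symmetric])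
    \<comment> \<open>A point outside \<open>N\<close> near \<open>2 x\<close> shows that \<open>S x\<close> is non-empty.\<close>
    have "beyond R' x ((2 * r) *\<^sub>R \<sigma>)" unfolding s(2) using s(1) r R by (intro beyond_scaleR) auto
    then obtain y where "y \<notin> N" "beyond R' x y" using meets[OF op1[of x]] by auto
    then show "S x \<noteq> {}" by (auto simp: S_def)
    \<comment> \<open>A point outside \<open>N\<close> near \<open>R' \<sigma>\<close> gives an upper bound; here \<open>R' < R\<close> is essential.\<close>
    have "beyond R' (R' *\<^sub>R \<sigma>) x" unfolding s(2) using s(1) r R by (intro beyond_scaleR) auto
    then obtain z where z: "z \<notin> N" "beyond R' z x" using meets[OF op2[of x]] by auto
    have "v \<le> f z" if "v \<in> S x" for v
      using that D[OF z(1)] z(2) beyond_trans[OF R(1) z(2)] by (auto simp: S_def)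
    then show "bdd_above (S x)" by (rule bdd_aboveI)
  qed
  define g where "g x = (if norm x < R then f x else Sup (S x))" for x
  have "f x = g x" if "x \<notin> N" for x
  proof (cases "norm x < R")
    case False
    have "Sup (S x) = f x"
      using D that by (intro cSup_eq_maximum) (auto simp: S_def)
    then show ?thesis using False by (simp add: g_def)
  qed (simp add: g_def)
  moreover have "AE x in lborel. x \<notin> N"
    using N AE_not_in[of N "completion lborel"] by (simp add: negligible_iff_null_sets AE_completion_iff)
  ultimately have "AE x in lborel. f x = g x" by (auto elim: eventually_mono)
  moreover have "g (r' *\<^sub>R \<sigma>) \<le> g (r *\<^sub>R \<sigma>)" if s: "norm \<sigma> = 1" and r: "R \<le> r" "r \<le> r'" for \<sigma> :: 'a and r r'
  proof (cases "r = r'")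
    case False
    then have b: "beyond R' (r *\<^sub>R \<sigma>) (r' *\<^sub>R \<sigma>)" using s r R by (intro beyond_scaleR) auto
    have n: "norm (r *\<^sub>R \<sigma>) = r" "norm (r' *\<^sub>R \<sigma>) = r'" using s r R by auto
    have "S (r' *\<^sub>R \<sigma>) \<subseteq> S (r *\<^sub>R \<sigma>)"
      using b beyond_trans[OF R(1) b] by (auto simp: S_def)
    then have "Sup (S (r' *\<^sub>R \<sigma>)) \<le> Sup (S (r *\<^sub>R \<sigma>))"
      using S[of "r *\<^sub>R \<sigma>"] S[of "r' *\<^sub>R \<sigma>"] n r by (intro cSup_subset_mono) auto
    then show ?thesis using n r by (simp add: g_def)
  qed simp
  ultimately show ?thesis
    unfolding radially_decreasing_beyond_def by (intro exI[of _ g]) (auto simp: monotone_on_def)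
qed

section \<open>Radial monotonicity of mild solutions\<close>

text \<open>
  By the Lindelof property countably many of the open sets in the definition of the essential support
  suffice.
\<close>

lemma AE_zero_outside_ess_support:
  fixes f :: "'a::euclidean_space \<Rightarrow> real"
  shows "AE x in lborel. x \<notin> ess_support f \<longrightarrow> f x = 0"
proof -
  let ?F = "{W. open W \<and> (AE x in lborel. x \<in> W \<longrightarrow> f x = 0)}"
  obtain F where F: "F \<subseteq> ?F" "countable F" "\<Union>F = \<Union>?F"
    using Lindelof[of ?F] by blast
  have "AE x in lborel. \<forall>W\<in>F. x \<in> W \<longrightarrow> f x = 0"
    using F by (intro AE_ball_countable') auto
  then show ?thesis
  proof eventually_elim
    case (elim x)
    then have "x \<in> \<Union>F \<longrightarrow> f x = 0" by blast
    then show ?case unfolding ess_support_def F(3) by blast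
  qed
qed

text \<open>
  The support keeps a positive distance from the sphere of radius \<open>R\<close>. This room is what makes the
  monotone representative finite on that sphere itself.
\<close>

lemma compactly_supported_in_ball_shrink:
  fixes f :: "'a::euclidean_space \<Rightarrow> real"
  assumes "compactly_supported_in f (ball 0 R)" "0 < R"
  obtains r where "0 \<le> r" "r < R" "AE x in lborel. r \<le> norm x \<longrightarrow> f x = 0"
proof -
  let ?K = "insert 0 (ess_support f)"
  have K: "compact ?K" "?K \<subseteq> ball 0 R" using assms by (auto simp: compactly_supported_in_def)
  obtain a where a: "a \<in> ?K" "\<And>x. x \<in> ?K \<Longrightarrow> norm x \<le> norm a"
    using continuous_attains_sup[OF K(1) _ continuous_on_norm_id] by blast
  have "norm a < R" using a(1) K(2) by (metis mem_ball_0 subsetD)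
  define r where "r = (norm a + R) / 2"
  have r: "norm a < r" "r < R" using \<open>norm a < R\<close> by (auto simp: r_def)
  have "AE x in lborel. r \<le> norm x \<longrightarrow> f x = 0"
    using AE_zero_outside_ess_support[of f]
  proof eventually_elim
    case (elim x)
    show ?case using elim a(2)[of x] r by auto
  qed
  then show ?thesis using r that[of r] norm_ge_zero[of a] by linarith
qed

theorem theorem1p2:
  fixes s p m R :: real
    and u0 :: "'a::euclidean_space \<Rightarrow> real"
    and u :: "real \<Rightarrow> 'a \<Rightarrow> real"
  assumes "0 < s" and "s < 1" and "1 < p" and "s < m" and "0 < R"
    and "u0 \<in> Lspace 1"
    and "AE x in lborel. 0 \<le> u0 x"
    and "compactly_supported_in u0 (ball 0 R)"
    and "mild_solution s p m u0 u"
  shows "\<forall>t\<ge>0. radially_decreasing_beyond R (u t)"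
proof (intro allI impI)
  fix t :: real assume t: "0 \<le> t"
  have ut: "u t \<in> Lspace 1" using assms(9) t by (auto simp: mild_solution_def)
  obtain r where r: "0 \<le> r" "r < R" and out: "AE x in lborel. r \<le> norm x \<longrightarrow> u0 x = 0"
    using compactly_supported_in_ball_shrink[OF assms(8,5)] by blast
  show "radially_decreasing_beyond R (u t)"
  proof (rule radially_decreasing_beyond_if_reflections[OF _ r])
    show "u t \<in> borel_measurable borel" using ut by (auto simp: Lspace_def)
    fix \<sigma> :: 'a and l :: real assume n: "norm \<sigma> = 1" and l: "r \<le> l"
    \<comment> \<open>The outer half-space misses the open ball of radius \<open>r\<close>, outside which \<open>u0\<close> vanishes.\<close>
    have large: "r \<le> norm z" if "l \<le> z \<bullet> \<sigma>" for z
      using Cauchy_Schwarz_ineq2[of z \<sigma>] n l that by simp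
    have "AE x in lborel. refl_excess \<sigma> l u0 x \<le> 0"
      using out assms(7) AE_hrefl[OF n out, of l] AE_hrefl[OF n assms(7), of l]
    proof eventually_elim
      case (elim x)
      then show ?case
        using large[of x] large[of "hrefl \<sigma> l x"] by (auto simp: refl_excess_def inner_hrefl[OF n])
    qed
    then have "refl_defect \<sigma> l u0 = 0" using refl_defect_eq_0_iff[OF n assms(6)] by simp
    moreover have "refl_defect \<sigma> l (u t) \<le> refl_defect \<sigma> l u0"
      using assms by (intro refl_defect_mild_solution[OF n _ _ _ _ _ t]) auto
    ultimately have "refl_defect \<sigma> l (u t) = 0" using refl_defect_nonneg[of \<sigma> l "u t"] by simp
    then have "AE x in lborel. refl_excess \<sigma> l (u t) x \<le> 0" using refl_defect_eq_0_iff[OF n ut] by simp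
    then show "AE z in lborel. z \<bullet> \<sigma> \<le> l \<longrightarrow> u t (hrefl \<sigma> l z) \<le> u t z"
      by eventually_elim (auto simp: refl_excess_def)
  qed
qed

end
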